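(* Let $X$ be a separable Banach space and $\lambda\ge 1$. Then $X$ has the $\lambda$-UBAP if and only if for any $\varepsilon>0$, $X$ embeds as a $(\lambda+\varepsilon)$-complemented subspace of a Banach space $Y_\varepsilon$ with a $1$-unconditional finite-dimensional decomposition ($1$-UFDD).
   Context: Approximating sequence: a sequence $\{S_n\}_{n=1}^\infty$ of bounded finite rank operators on $X$ converging strongly (pointwise in norm) to the identity operator, with $S_mS_n=S_n$ for all $n<m$ (and hence $\limsup_n\|S_n\|<\infty$). $\lambda$-UBAP ($\lambda$-unconditional bounded approximation property): a separable Banach space $X$ has it if for every $\varepsilon>0$ there is an approximating sequence $\{S_n\}$ such that, with $S_0=0$ and $A_n=S_n-S_{n-1}$, $\sup_{N\in\mathbb{N}_+,\,\theta_i=\pm1}\|\sum_{i=1}^N\theta_iA_i\|\le\lambda+\varepsilon$. Complemented embedding: a closed subspace $Z$ of a Banach space $Y$ is $c$-complemented if there is a bounded linear projection of $Y$ onto $Z$ of norm at most $c$. $X$ embeds as a $c$-complemented subspace of $Y$ if there is a linear embedding (isomorphism onto its image) of $X$ into $Y$ whose image is a $c$-complemented subspace of $Y$. UFDD: a sequence $\{E_n\}_{n=1}^\infty$ of finite-dimensional subspaces of a Banach space $Y$ is an unconditional finite-dimensional decomposition of $Y$ if for every $y\in Y$ there is a unique sequence $y_n\in E_n$ with $y=\sum_n y_n$, and this series converges unconditionally. For $\mu\ge1$, $Y$ has the $\mu$-UFDD if for every $\delta>0$ there is such a sequence $\{E_n\}$ with $\sup_{\epsilon_n=\pm1}\|\sum_n\epsilon_ny_n\|\le(\mu+\delta)\|\sum_ny_n\|$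 for all $y=\sum_n y_n$, $y_n\in E_n$.
   Formalization: Repaired: the embedding J of X into Y and the projection P must satisfy ‖J‖·‖J⁻¹P‖ ≤ λ+ε, not only ‖P‖ ≤ λ+ε (else "if" fails under renorming of X); Y_ε ranges over closed subspaces of a fixed real Banach space containing ℓ∞ isometrically. *)

theory Defs
  imports "HOL-Analysis.Analysis"
begin

definition finite_dimensional :: "'a::real_vector set \<Rightarrow> bool" where
  "finite_dimensional V \<longleftrightarrow> (\<exists>B. finite B \<and> V = span B)"

definition sign_sequence :: "(nat \<Rightarrow> real) \<Rightarrow> bool" where
  "sign_sequence \<theta> \<longleftrightarrow> (\<forall>i. \<theta> i = 1 \<or> \<theta> i = -1)"

section \<open>The unconditional bounded approximation property\<close>

text \<open>Sequences are indexed from 1; the value \<open>S 0\<close> is irrelevant.\<close>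

definition approximating_sequence ::
    "(nat \<Rightarrow> 'a::real_normed_vector \<Rightarrow>\<^sub>L 'a) \<Rightarrow> bool" where
  "approximating_sequence S \<longleftrightarrow>
     (\<forall>n\<ge>1. finite_dimensional (range (blinfun_apply (S n)))) \<and>
     (\<forall>x. (\<lambda>n. blinfun_apply (S n) x) \<longlonglongrightarrow> x) \<and>
     (\<forall>n m. 1 \<le> n \<and> n < m \<longrightarrow> S m o\<^sub>L S n = S n)"

definition increment ::
    "(nat \<Rightarrow> 'a::real_normed_vector \<Rightarrow>\<^sub>L 'a) \<Rightarrow> nat \<Rightarrow> 'a \<Rightarrow>\<^sub>L 'a" where
  "increment S n = (if n = 1 then S 1 else S n - S (n - 1))"

definition has_UBAP :: "'a::real_normed_vector itself \<Rightarrow> real \<Rightarrow> bool" where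
  "has_UBAP (X :: 'a itself) lam \<longleftrightarrow>
     (\<forall>\<epsilon>>0. \<exists>S :: nat \<Rightarrow> 'a \<Rightarrow>\<^sub>L 'a. approximating_sequence S \<and>
        (\<forall>N\<ge>1. \<forall>\<theta>. sign_sequence \<theta> \<longrightarrow>
           norm (\<Sum>i=1..N. \<theta> i *\<^sub>R increment S i) \<le> lam + \<epsilon>))"

section \<open>Banach spaces as closed subspaces of an ambient Banach space\<close>

text \<open>
  HOL cannot quantify over types inside a formula, so "there is a Banach space \<open>Y\<close>" is rendered
  as "there is a closed linear subspace \<open>Y\<close> of \<open>'b\<close>", where \<open>'b\<close> is an arbitrary Banach space
  into which l-infinity (the bounded functions on the discrete space \<open>nat\<close>) embeds linearly and
  isometrically. This loses nothing: every separable Banach space, in particular every space with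
  a finite-dimensional decomposition, is isometric to a closed subspace of l-infinity, and every
  Banach space \<open>W\<close> is a closed subspace of such a \<open>'b\<close> (the sum of \<open>W\<close> and l-infinity).
\<close>

definition contains_l_infinity :: "'b::real_normed_vector itself \<Rightarrow> bool" where
  "contains_l_infinity (B :: 'b itself) \<longleftrightarrow>
     (\<exists>U :: (nat \<Rightarrow>\<^sub>C real) \<Rightarrow> 'b. linear U \<and> (\<forall>f. norm (U f) = norm f))"

definition banach_subspace :: "'b::banach set \<Rightarrow> bool" where
  "banach_subspace Y \<longleftrightarrow> subspace Y \<and> closed Y"

section \<open>Unconditional finite-dimensional decompositions\<close>

text \<open>Unconditional convergence is \<open>summable_on\<close>: convergence along the net of finite index sets.\<close>

definition UFDD :: "'b::banach set \<Rightarrow> (nat \<Rightarrow> 'b set) \<Rightarrow> bool" where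
  "UFDD Y E \<longleftrightarrow>
     (\<forall>n. E n \<subseteq> Y \<and> finite_dimensional (E n)) \<and>
     (\<forall>y\<in>Y. (\<exists>!f. (\<forall>n. f n \<in> E n) \<and> f sums y) \<and>
             (\<forall>f. (\<forall>n. f n \<in> E n) \<and> f sums y \<longrightarrow> f summable_on UNIV))"

definition has_UFDD :: "'b::banach set \<Rightarrow> real \<Rightarrow> bool" where
  "has_UFDD Y \<mu> \<longleftrightarrow>
     (\<forall>\<delta>>0. \<exists>E. UFDD Y E \<and>
        (\<forall>y\<in>Y. \<forall>f. (\<forall>n. f n \<in> E n) \<and> f sums y \<longrightarrow>
           (\<forall>\<theta>. sign_sequence \<theta> \<longrightarrow> norm (\<Sum>n. \<theta> n *\<^sub>R f n) \<le> (\<mu> + \<delta>) * norm y)))"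

section \<open>Complemented embeddings\<close>

definition linear_into :: "'b::real_vector set \<Rightarrow> 'b set \<Rightarrow> ('b \<Rightarrow> 'b) \<Rightarrow> bool" where
  "linear_into Y Z P \<longleftrightarrow>
     (\<forall>y\<in>Y. P y \<in> Z) \<and>
     (\<forall>y\<in>Y. \<forall>y'\<in>Y. P (y + y') = P y + P y') \<and>
     (\<forall>c. \<forall>y\<in>Y. P (c *\<^sub>R y) = c *\<^sub>R P y)"

definition projection_bounded_by ::
    "real \<Rightarrow> 'b::banach set \<Rightarrow> 'b set \<Rightarrow> ('b \<Rightarrow> 'b) \<Rightarrow> bool" where
  "projection_bounded_by c Y Z P \<longleftrightarrow>
     banach_subspace Z \<and> Z \<subseteq> Y \<and> linear_into Y Z P \<and> (\<forall>z\<in>Z. P z = z) \<and>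
     (\<forall>y\<in>Y. norm (P y) \<le> c * norm y)"

definition isomorphic_embedding ::
    "('a::real_normed_vector \<Rightarrow> 'b::real_normed_vector) \<Rightarrow> bool" where
  "isomorphic_embedding J \<longleftrightarrow> bounded_linear J \<and> (\<exists>a>0. \<forall>x. a * norm x \<le> norm (J x))"

text \<open>
  The constant of a complemented copy of \<open>X\<close> has to refer to the norm of \<open>X\<close>: the last clause says
  that \<open>\<parallel>J\<parallel> \<parallel>J\<inverse> P\<parallel> \<le> c\<close>, which strengthens \<open>\<parallel>P\<parallel> \<le> c\<close> and is equivalent to it when \<open>J\<close> is
  isometric. With \<open>\<parallel>P\<parallel> \<le> c\<close> alone the property would not change when \<open>X\<close> is given an equivalent
  norm, whereas the constant in the UBAP does change: for the equivalent norm
  \<open>max \<parallel>x\<parallel>\<^sub>2 (SUP k\<ge>1. \<bar>x 0 + x k\<bar>)\<close> on the Hilbert space of square-summable sequences, the constant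
  1 fails in the UBAP, although the identity maps onto a Hilbert space. Requiring \<open>J\<close> to be
  isometric is too much: L4[0,1] has the UBAP for some constant, but is not isometric to a subspace
  of a space with a 1-UFDD.
\<close>

definition embeds_complemented ::
    "'a::banach itself \<Rightarrow> real \<Rightarrow> 'b::banach set \<Rightarrow> bool" where
  "embeds_complemented (X :: 'a itself) c Y \<longleftrightarrow>
     (\<exists>(J :: 'a \<Rightarrow> 'b) P. isomorphic_embedding J \<and> projection_bounded_by c Y (range J) P \<and>
        (\<forall>y\<in>Y. \<forall>x. P y = J x \<longrightarrow> onorm J * norm x \<le> c * norm y))"

end

(*
  UBAP gives the complemented embedding: let A n be the increments of an approximating sequence S.
  Take independent copies of the ranges of the A n, normed by the supremum of all signed partial
  sums. The norm is realised inside l-infinity by a norming sequence of functionals of X, evaluated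
  at all finite sign patterns. The map x |-> (A n x) embeds X, and adding up coordinates is a left
  inverse of norm at most 1; S m S n = S n and density make the embedding well defined.

  Conversely, compressing the partial sum operators of the decomposition to X gives finite rank
  operators T n converging to the identity with the right unconditional constant, but without
  S m S n = S n. A small perturbation of a subsequence restores this relation, and passing to a
  subsequence only merges signs into blocks.
*)
theory Submission
  imports Defs
begin

section \<open>Norming functionals\<close>

text \<open>The supremum over signed partial sums puts every loss in one place. Multiplying
  coordinates by signs only permutes the patterns, which gives the unconditional constant 1. The
  all-plus patterns make summation a contraction. So the whole factor lam + \<epsilon> sits in the
  norm of the embedding, exactly where the UBAP bounds it. Bounded signed sums alone do not make the
  series of \<open>W n (A n x)\<close> converge in l-infinity, since l-infinity contains c_0; hence
  the detour through the vectors \<open>S n x\<close>, on which late increments vanish. In the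
  converse the obstacle is that \<open>J\<close> may distort norms. Using only the lower bound
  \<open>a * norm x \<le> norm (J x)\<close> and the norm of \<open>P\<close> would leave a factor
  \<open>onorm J / a\<close> in the constant; the clause on \<open>onorm J * norm x\<close> removes
  it. The perturbation is small because strong convergence is uniform on the unit ball of a
  finite-dimensional space, the only place where the correction acts.\<close>

definition sublinear :: "('a::real_vector \<Rightarrow> real) \<Rightarrow> bool" where
  "sublinear p \<longleftrightarrow> (\<forall>x y. p (x + y) \<le> p x + p y) \<and> (\<forall>c>0. \<forall>x. p (c *\<^sub>R x) \<le> c * p x)"

lemma sublinear_add: "sublinear p \<Longrightarrow> p (x + y) \<le> p x + p y"
  by (simp add: sublinear_def)

lemma sublinear_zero:
  assumes "sublinear p" shows "p 0 = 0"
proof -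
  have "p (2 *\<^sub>R 0) \<le> 2 * p 0" "p ((1/2) *\<^sub>R 0) \<le> (1/2) * p 0"
    using assms unfolding sublinear_def by (metis zero_less_numeral, metis half_gt_zero_iff zero_less_one)
  then show ?thesis by simp
qed

lemma sublinear_scale:
  assumes "sublinear p" "c \<ge> 0" shows "p (c *\<^sub>R x) = c * p x"
proof (cases "c = 0")
  case True
  then show ?thesis using sublinear_zero[OF assms(1)] by simp
next
  case False
  then have c: "c > 0" using assms by simp
  have "p (inverse c *\<^sub>R (c *\<^sub>R x)) \<le> inverse c * p (c *\<^sub>R x)"
    using assms(1) c unfolding sublinear_def by (meson positive_imp_inverse_positive)
  then have "c * p x \<le> p (c *\<^sub>R x)" using c by (simp add: field_simps)
  moreover have "p (c *\<^sub>R x) \<le> c * p x" using assms(1) c unfolding sublinear_def by blast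
  ultimately show ?thesis by simp
qed

lemma sublinear_minus_le:
  assumes "sublinear p" shows "- p (- x) \<le> p x"
  using sublinear_add[OF assms, of x "- x"] sublinear_zero[OF assms] by simp

text \<open>Serves two infima: the one over a real parameter in \<open>sublinear_shift\<close> and
  the one over a chain in the Zorn argument. The index \<open>k\<close> may depend on the
  vectors.\<close>

lemma sublinear_INF:
  fixes g :: "'i \<Rightarrow> 'a::real_vector \<Rightarrow> real"
  assumes ne: "I \<noteq> {}" and bdd: "\<And>x. bdd_below ((\<lambda>i. g i x) ` I)"
    and add: "\<And>i j x y. i \<in> I \<Longrightarrow> j \<in> I \<Longrightarrow> \<exists>k\<in>I. g k (x + y) \<le> g i x + g j y"
    and scale: "\<And>i c x. i \<in> I \<Longrightarrow> c > 0 \<Longrightarrow> \<exists>k\<in>I. g k (c *\<^sub>R x) \<le> c * g i x"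
  shows "sublinear (\<lambda>x. INF i\<in>I. g i x)"
  unfolding sublinear_def
proof (intro conjI allI impI)
  fix x y
  have le: "(INF k\<in>I. g k (x + y)) \<le> g i x + g j y" if "i \<in> I" "j \<in> I" for i j
    using add[OF that, of x y] cINF_lower2[OF bdd] by blast
  have "(INF k\<in>I. g k (x + y)) - g i x \<le> (INF j\<in>I. g j y)" if "i \<in> I" for i
    using le[OF that] by (intro cINF_greatest ne) (simp add: algebra_simps)
  then have "(INF k\<in>I. g k (x + y)) - (INF j\<in>I. g j y) \<le> (INF i\<in>I. g i x)"
    by (intro cINF_greatest ne) (simp add: algebra_simps)
  then show "(INF k\<in>I. g k (x + y)) \<le> (INF i\<in>I. g i x) + (INF j\<in>I. g j y)" by simp
next
  fix c :: real and x assume c: "c > 0"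
  have le: "(INF k\<in>I. g k (c *\<^sub>R x)) \<le> c * g i x" if "i \<in> I" for i
    using scale[OF that c, of x] cINF_lower2[OF bdd] by blast
  have "(INF k\<in>I. g k (c *\<^sub>R x)) / c \<le> (INF i\<in>I. g i x)"
    using le c by (intro cINF_greatest ne) (simp add: field_simps)
  then show "(INF k\<in>I. g k (c *\<^sub>R x)) \<le> c * (INF i\<in>I. g i x)"
    using c by (simp add: field_simps)
qed

text \<open>Take for \<open>r x\<close> the infimum of \<open>q (x + t y) - t * q y\<close> over t
  >= 0: t = 0 gives \<open>r \<le> q\<close> and t = 1 gives the last bound. It lowers
  \<open>q\<close> wherever \<open>q\<close> fails to be additive.\<close>

lemma sublinear_shift:
  fixes q :: "'a::real_vector \<Rightarrow> real"
  assumes q: "sublinear q"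
  obtains r where "sublinear r" "r \<le> q" "\<And>x. r x \<le> q (x + y) - q y"
proof
  let ?g = "\<lambda>t x. q (x + t *\<^sub>R y) - t * q y"
  let ?r = "\<lambda>x. INF t\<in>{0..}. ?g t x"
  have bdd: "bdd_below ((\<lambda>t. ?g t x) ` {0..})" for x
  proof (rule bdd_belowI2[where m = "- q (- x)"])
    fix t :: real assume "t \<in> {0..}"
    then have "q (t *\<^sub>R y) = t * q y" using sublinear_scale[OF q] by simp
    moreover have "q (t *\<^sub>R y) \<le> q (x + t *\<^sub>R y) + q (- x)"
      using sublinear_add[OF q, of "x + t *\<^sub>R y" "- x"] by simp
    ultimately show "- q (- x) \<le> ?g t x" by simp
  qed
  show "sublinear ?r"
  proof (rule sublinear_INF[OF _ bdd])
    fix t s :: real and x x' assume "t \<in> {0..}" "s \<in> {0..}"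
    moreover have "?g (t + s) (x + x') \<le> ?g t x + ?g s x'"
      using sublinear_add[OF q, of "x + t *\<^sub>R y" "x' + s *\<^sub>R y"] by (simp add: algebra_simps)
    ultimately show "\<exists>k\<in>{0..}. ?g k (x + x') \<le> ?g t x + ?g s x'"
      by (intro bexI[of _ "t + s"]) auto
  next
    fix t c :: real and x assume "t \<in> {0..}" "c > 0"
    moreover have "?g (c * t) (c *\<^sub>R x) \<le> c * ?g t x"
      using sublinear_scale[OF q, of c "x + t *\<^sub>R y"] \<open>c > 0\<close> by (simp add: algebra_simps)
    ultimately show "\<exists>k\<in>{0..}. ?g k (c *\<^sub>R x) \<le> c * ?g t x"
      by (intro bexI[of _ "c * t"]) auto
  qed simp
  show "?r \<le> q"
    by (intro le_funI cINF_lower2[OF bdd, of 0]) auto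
  show "?r x \<le> q (x + y) - q y" for x
    by (intro cINF_lower2[OF bdd, of 1]) auto
qed

text \<open>Hahn-Banach by minimality: Zorn's lemma gives a minimal sublinear functional below
  \<open>p\<close>, and a minimal one cannot be lowered by \<open>sublinear_shift\<close>, so it is
  linear.\<close>

lemma linear_below_sublinear:
  fixes p :: "'a::real_vector \<Rightarrow> real"
  assumes p: "sublinear p"
  obtains f where "linear f" "f \<le> p"
proof -
  let ?A = "{q. sublinear q \<and> q \<le> p}"
  have "\<exists>m\<in>?A. \<forall>q\<in>?A. m \<ge> q \<longrightarrow> q = m"
  proof (rule predicate_Zorn)
    show "partial_order_on ?A (relation_of (\<ge>) ?A)"
      by (rule partial_order_on_relation_ofI) auto
  next
    fix C assume "C \<in> Chains (relation_of (\<ge>) ?A)"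
    then have C: "C \<subseteq> ?A" and chain: "\<And>q r. q \<in> C \<Longrightarrow> r \<in> C \<Longrightarrow> q \<le> r \<or> r \<le> q"
      unfolding Chains_def relation_of_def by blast+
    show "\<exists>u\<in>?A. \<forall>q\<in>C. q \<ge> u"
    proof (cases "C = {}")
      case True
      then show ?thesis using p by auto
    next
      case False
      have bdd: "bdd_below ((\<lambda>q. q x) ` C)" for x
      proof (rule bdd_belowI2[where m = "- p (- x)"])
        fix q assume "q \<in> C"
        then have "sublinear q" "q (- x) \<le> p (- x)" using C by (auto simp: le_fun_def)
        then show "- p (- x) \<le> q x" using sublinear_minus_le[of q x] by simp
      qed
      have "sublinear (\<lambda>x. INF q\<in>C. q x)"
      proof (rule sublinear_INF[OF False bdd])
        fix q r x y assume qr: "q \<in> C" "r \<in> C"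
        then have "\<exists>k\<in>C. k \<le> q \<and> k \<le> r" using chain[OF qr] by blast
        then obtain k where k: "k \<in> C" "k x \<le> q x" "k y \<le> r y" by (auto simp: le_fun_def)
        then have "k (x + y) \<le> k x + k y" using C sublinear_add[of k] by blast
        then show "\<exists>k\<in>C. k (x + y) \<le> q x + r y" using k by (intro bexI[of _ k]) auto
      next
        fix q c x assume "q \<in> C" "(c::real) > 0"
        then show "\<exists>k\<in>C. k (c *\<^sub>R x) \<le> c * q x"
          using C sublinear_scale[of q c x] by (intro bexI[of _ q]) auto
      qed
      moreover have "(\<lambda>x. INF q\<in>C. q x) \<le> q" if "q \<in> C" for q
        using that by (intro le_funI cINF_lower bdd)
      ultimately show ?thesis
        using False C by (intro bexI[of _ "\<lambda>x. INF q\<in>C. q x"]) (auto intro: order_trans)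
    qed
  qed
  then obtain m where m: "sublinear m" "m \<le> p"
    and min: "\<And>q. sublinear q \<Longrightarrow> q \<le> p \<Longrightarrow> q \<le> m \<Longrightarrow> q = m" by blast
  \<comment> \<open>The shifted functional equals \<open>m\<close> by minimality, so its last bound
    says that \<open>m\<close> is superadditive.\<close>
  have add: "m (x + y) = m x + m y" for x y
  proof -
    obtain r where r: "sublinear r" "r \<le> m" "\<And>x. r x \<le> m (x + y) - m y"
      using sublinear_shift[OF m(1)] by blast
    then have "r = m" using min m(2) by (meson order_trans)
    then show ?thesis using r(3)[of x] sublinear_add[OF m(1), of x y] by simp
  qed
  have neg: "m (- x) = - m x" for x
    using add[of x "- x"] sublinear_zero[OF m(1)] by simp
  have "m (c *\<^sub>R x) = c * m x" for c x
    using sublinear_scale[OF m(1), of c x] sublinear_scale[OF m(1), of "- c" x] neg[of "c *\<^sub>R x"]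
    by (cases "c \<ge> 0") auto
  then have "linear m" using add by (intro linearI) auto
  then show thesis using m(2) that by blast
qed

text \<open>Shifting the norm at \<open>x0\<close> gives \<open>r (- x0) \<le> - norm x0\<close>, so
  every linear functional below \<open>r\<close> must attain \<open>norm x0\<close> at
  \<open>x0\<close>.\<close>

lemma norming_functional:
  fixes x0 :: "'a::real_normed_vector"
  obtains f :: "'a \<Rightarrow> real" where "linear f" "\<And>x. \<bar>f x\<bar> \<le> norm x" "f x0 = norm x0"
proof -
  have "sublinear (norm :: 'a \<Rightarrow> real)" by (simp add: sublinear_def norm_triangle_ineq)
  then obtain r where r: "sublinear r" "r \<le> (norm :: 'a \<Rightarrow> real)"
      "\<And>x. r x \<le> norm (x + x0) - norm x0"
    using sublinear_shift by blast
  obtain f where f: "linear f" "f \<le> r" using linear_below_sublinear[OF r(1)] by blast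
  have le: "f x \<le> norm x" for x using f(2) r(2) by (meson le_funD order_trans)
  have abs: "\<bar>f x\<bar> \<le> norm x" for x
    using le[of x] le[of "- x"] linear_neg[OF f(1), of x] by simp
  have "f (- x0) \<le> - norm x0" using le_funD[OF f(2), of "- x0"] r(3)[of "- x0"] by simp
  then have "f x0 = norm x0" using le[of x0] linear_neg[OF f(1), of x0] by simp
  then show thesis using that f(1) abs by blast
qed

text \<open>One functional is taken for each point of a countable dense set. Passing between
  \<open>x\<close> and a dense point costs their distance twice, once in the functional and once in
  the norm.\<close>

lemma separable_norming_sequence:
  assumes "separable_space (euclidean :: 'a::real_normed_vector topology)"
  obtains f :: "nat \<Rightarrow> 'a::real_normed_vector \<Rightarrow> real" where "\<And>k. linear (f k)" "\<And>k x. \<bar>f k x\<bar> \<le> norm x"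
    "\<And>x C. (\<And>k. \<bar>f k x\<bar> \<le> C) \<Longrightarrow> norm x \<le> C"
proof -
  obtain D :: "'a set" where D: "countable D" "closure D = UNIV"
    using assms unfolding separable_space_def by auto
  then have ne: "D \<noteq> {}" by auto
  define d where "d = from_nat_into D"
  have "\<forall>k. \<exists>g :: 'a \<Rightarrow> real. linear g \<and> (\<forall>x. \<bar>g x\<bar> \<le> norm x) \<and> g (d k) = norm (d k)"
    using norming_functional by metis
  then obtain f :: "nat \<Rightarrow> 'a \<Rightarrow> real" where f: "\<And>k. linear (f k)"
    "\<And>k x. \<bar>f k x\<bar> \<le> norm x" "\<And>k. f k (d k) = norm (d k)" by metis
  have "norm x \<le> C" if C: "\<And>k. \<bar>f k x\<bar> \<le> C" for x C
  proof (rule field_le_epsilon)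
    fix e :: real assume "e > 0"
    then obtain y where "y \<in> D" "dist y x < e / 2"
      using D(2) closure_approachable[of x D] by (metis UNIV_I half_gt_zero)
    then obtain k where k: "dist (d k) x < e / 2"
      using from_nat_into_surj[OF D(1)] unfolding d_def by blast
    have "norm (d k) = f k x + f k (d k - x)" using f(3) linear_diff[OF f(1)] by simp
    also have "\<dots> \<le> C + norm (d k - x)" using C[of k] f(2)[of k "d k - x"] by linarith
    finally have "norm (d k) \<le> C + norm (d k - x)" .
    then show "norm x \<le> C + e"
      using k norm_triangle_sub[of x "d k"] by (simp add: dist_norm norm_minus_commute)
  qed
  then show thesis using f that by blast
qed

section \<open>Finite-dimensional subspaces\<close>

text \<open>Closedness and the bound go through one induction: a new generator outside the closed
  old span has positive distance \<open>d\<close> from it, and this controls its coefficient. That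
  \<open>C\<close> does not depend on \<open>L\<close> is what later turns pointwise convergence on
  \<open>B\<close> into uniform convergence.\<close>

lemma finite_span_linear_bound:
  fixes B :: "'a::real_normed_vector set"
  assumes "finite B"
  shows "closed (span B) \<and> (\<exists>C\<ge>0. \<forall>x\<in>span B. \<forall>L::'a \<Rightarrow> 'b::real_normed_vector. linear L \<longrightarrow>
    norm (L x) \<le> C * (\<Sum>b\<in>B. norm (L b)) * norm x)"
  using assms
proof (induction B rule: finite_induct)
  case empty
  then show ?case by (auto simp: linear_0 intro: exI[of _ 0])
next
  case (insert a B)
  then obtain C where cl: "closed (span B)" and C: "C \<ge> 0"
    "\<And>x L::'a \<Rightarrow> 'b. x \<in> span B \<Longrightarrow> linear L \<Longrightarrow> norm (L x) \<le> C * (\<Sum>b\<in>B. norm (L b)) * norm x"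
    by blast
  show ?case
  proof (cases "a \<in> span B")
    case True
    have "norm (L x) \<le> C * (\<Sum>b\<in>insert a B. norm (L b)) * norm x"
      if "x \<in> span B" "linear L" for x and L :: "'a \<Rightarrow> 'b"
    proof -
      have "C * (\<Sum>b\<in>B. norm (L b)) * norm x \<le> C * (\<Sum>b\<in>insert a B. norm (L b)) * norm x"
        using C(1) insert.hyps by (intro mult_right_mono mult_left_mono) auto
      then show ?thesis using C(2)[OF that] by linarith
    qed
    then show ?thesis using cl C(1) span_redundant[OF True] by auto
  next
    case False
    then obtain d where d: "d > 0" "\<And>v. v \<in> span B \<Longrightarrow> d \<le> dist a v"
      using closed_approachable[OF cl, of a] by (metis dist_commute not_le)
    have dist: "d * \<bar>c\<bar> \<le> norm (c *\<^sub>R a + v)" if "v \<in> span B" for c v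
    proof (cases "c = 0")
      case False
      have "d \<le> dist a ((- inverse c) *\<^sub>R v)" using d(2) span_scale[OF that] by blast
      also have "\<dots> = norm (inverse c *\<^sub>R (c *\<^sub>R a + v))"
        using False by (simp add: dist_norm algebra_simps)
      also have "\<dots> = norm (c *\<^sub>R a + v) / \<bar>c\<bar>" by (simp add: divide_inverse mult.commute)
      finally show ?thesis using False by (simp add: field_simps)
    qed auto
    have decomp: "\<exists>c v. v \<in> span B \<and> x = c *\<^sub>R a + v" if "x \<in> span (insert a B)" for x
      using span_breakdown_eq[of x a B] that by (metis add.commute diff_add_cancel)
    \<comment> \<open>The coefficient of \<open>a\<close> is at most \<open>norm x / d\<close>,
      which gives the first term; the remainder in \<open>span B\<close> then has norm at most
      \<open>(1 + norm a / d) * norm x\<close>, which the old constant multiplies.\<close>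
    define C' where "C' = 1 / d + C * (1 + norm a / d)"
    have C': "C' \<ge> 0" using C(1) d(1) by (simp add: C'_def)
    have bound: "norm (L x) \<le> C' * (\<Sum>b\<in>insert a B. norm (L b)) * norm x"
      if x: "x \<in> span (insert a B)" and L: "linear L" for x and L :: "'a \<Rightarrow> 'b"
    proof -
      obtain c v where v: "v \<in> span B" "x = c *\<^sub>R a + v" using decomp[OF x] by blast
      define s where "s = (\<Sum>b\<in>B. norm (L b))"
      have s: "s \<ge> 0" by (simp add: s_def sum_nonneg)
      have c: "\<bar>c\<bar> \<le> norm x / d" using dist[OF v(1), of c] v(2) d(1) by (simp add: field_simps)
      have "norm v \<le> norm x + \<bar>c\<bar> * norm a"
        using norm_triangle_ineq4[of x "c *\<^sub>R a"] v(2) by simp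
      also have "\<dots> \<le> norm x + (norm x / d) * norm a" by (intro add_left_mono mult_right_mono c) auto
      finally have nv: "norm v \<le> (1 + norm a / d) * norm x" by (simp add: algebra_simps)
      have "norm (L x) \<le> \<bar>c\<bar> * norm (L a) + norm (L v)"
        using norm_triangle_ineq[of "c *\<^sub>R L a" "L v"] v(2) by (simp add: linear_add[OF L] linear_scale[OF L])
      also have "\<dots> \<le> (norm x / d) * norm (L a) + (C * s) * ((1 + norm a / d) * norm x)"
        using C(2)[OF v(1) L] nv s C(1) unfolding s_def[symmetric]
        by (intro add_mono mult_right_mono c order_trans[OF C(2)[OF v(1) L, folded s_def]] mult_left_mono) auto
      also have "\<dots> \<le> C' * norm (L a) * norm x + C' * s * norm x"
      proof (rule add_mono)
        have "(1 / d) * (norm (L a) * norm x) \<le> C' * (norm (L a) * norm x)"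
          using C(1) d(1) by (intro mult_right_mono) (auto simp: C'_def)
        then show "norm x / d * norm (L a) \<le> C' * norm (L a) * norm x" by (simp add: mult_ac)
        have "(C * (1 + norm a / d)) * (s * norm x) \<le> C' * (s * norm x)"
          using s d(1) by (intro mult_right_mono) (auto simp: C'_def)
        then show "C * s * ((1 + norm a / d) * norm x) \<le> C' * s * norm x" by (simp add: mult_ac)
      qed
      also have "\<dots> = C' * (\<Sum>b\<in>insert a B. norm (L b)) * norm x"
        using insert.hyps by (simp add: s_def algebra_simps)
      finally show ?thesis .
    qed
    have "closed (span (insert a B))"
    proof (rule closed_sequential_limits[THEN iffD2], intro allI impI)
      fix x l assume "(\<forall>n. x n \<in> span (insert a B)) \<and> x \<longlonglongrightarrow> l"
      then have x: "\<And>n. x n \<in> span (insert a B)" and l: "x \<longlonglongrightarrow> l" by auto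
      obtain c v where v: "\<And>n. v n \<in> span B" "\<And>n. x n = c n *\<^sub>R a + v n"
        using decomp[OF x] by metis
      \<comment> \<open>The coefficients of \<open>a\<close> form a Cauchy sequence by the distance
        bound; the remainders are left to the closedness of \<open>span B\<close>.\<close>
      have "d * \<bar>c m - c n\<bar> \<le> norm (x m - x n)" for m n
        using dist[OF span_diff[OF v(1) v(1)], of "c m - c n" m n] v(2) by (simp add: algebra_simps)
      then have cd: "dist (c m) (c n) \<le> dist (x m) (x n) / d" for m n
        using d(1) by (simp add: dist_norm field_simps)
      have "Cauchy c"
      proof (rule metric_CauchyI)
        fix e :: real assume "e > 0"
        then obtain M where "\<And>m n. m \<ge> M \<Longrightarrow> n \<ge> M \<Longrightarrow> dist (x m) (x n) < e * d"
          using metric_CauchyD[OF LIMSEQ_imp_Cauchy[OF l], of "e * d"] d(1) by auto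
        then show "\<exists>M. \<forall>m\<ge>M. \<forall>n\<ge>M. dist (c m) (c n) < e"
          using cd d(1) by (metis le_less_trans pos_divide_less_eq)
      qed
      then obtain c0 where c0: "c \<longlonglongrightarrow> c0" using real_Cauchy_convergent convergent_def by blast
      have "(\<lambda>n. x n - c n *\<^sub>R a) \<longlonglongrightarrow> l - c0 *\<^sub>R a" by (intro tendsto_intros l c0)
      then have "l - c0 *\<^sub>R a \<in> span B"
        using closed_sequentially[OF cl, of "\<lambda>n. x n - c n *\<^sub>R a"] v by simp
      then show "l \<in> span (insert a B)" unfolding span_breakdown_eq by blast
    qed
    then show ?thesis using C' bound by blast
  qed
qed

lemma finite_dimensional_linear_bound:
  assumes "finite_dimensional (V :: 'a::real_normed_vector set)"
  obtains B C where "finite B" "V = span B" "C \<ge> 0"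
    "\<And>x (L :: 'a \<Rightarrow> 'b::real_normed_vector). x \<in> V \<Longrightarrow> linear L \<Longrightarrow>
      norm (L x) \<le> C * (\<Sum>b\<in>B. norm (L b)) * norm x"
proof -
  obtain B where B: "finite B" "V = span B" using assms unfolding finite_dimensional_def by blast
  show thesis using finite_span_linear_bound[OF B(1), where 'b='b] B that by blast
qed

lemma finite_dimensional_closed:
  assumes "finite_dimensional (V :: 'a::real_normed_vector set)"
  shows "closed V"
proof -
  obtain B where "finite B" "V = span B" using assms unfolding finite_dimensional_def by blast
  then show ?thesis using conjunct1[OF finite_span_linear_bound[where 'b = 'a]] by metis
qed

lemma finite_dimensional_subspace:
  "finite_dimensional V \<Longrightarrow> subspace V"
  unfolding finite_dimensional_def by auto

lemma finite_dimensional_subset: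
  assumes "subspace W" "W \<subseteq> span B" "finite B"
  shows "finite_dimensional W"
proof -
  obtain A where A: "A \<subseteq> W" "independent A" "span A = W"
    using basis_exists[of W] assms(1) by (metis span_subspace)
  then have "finite A" using independent_span_bound[OF assms(3) A(2)] assms(2) by auto
  then show ?thesis using A(3) unfolding finite_dimensional_def by blast
qed

lemma finite_dimensional_image:
  assumes "linear f" "finite_dimensional V"
  shows "finite_dimensional (f ` V)"
  using assms unfolding finite_dimensional_def by (metis finite_imageI linear_span_image)

lemma finite_dimensional_range_add:
  fixes S T :: "'a::real_normed_vector \<Rightarrow>\<^sub>L 'b::real_normed_vector"
  assumes "finite_dimensional (range S)" "finite_dimensional (range T)"
  shows "finite_dimensional (range (S + T))"
proof -
  obtain A B where "finite A" "range S = span A" "finite B" "range T = span B"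
    using assms unfolding finite_dimensional_def by blast
  then have "S x + T x \<in> span (A \<union> B)" for x
    by (metis Un_upper1 Un_upper2 rangeI span_add span_mono subsetD)
  then show ?thesis
    using \<open>finite A\<close> \<open>finite B\<close>
    by (intro finite_dimensional_subset[of _ "A \<union> B"] linear_subspace_image blinfun.bounded_linear_right
       bounded_linear.linear subspace_UNIV) (auto simp: blinfun.add_left)
qed

text \<open>The bound for \<open>D n\<close> on \<open>V\<close> involves only its values at
  finitely many generators, and these tend to 0.\<close>

lemma strong_limit_uniform_on_finite_dimensional:
  fixes D :: "nat \<Rightarrow> 'a::real_normed_vector \<Rightarrow>\<^sub>L 'b::real_normed_vector"
  assumes V: "finite_dimensional V" and D: "\<And>x. (\<lambda>n. D n x) \<longlonglongrightarrow> 0" and e: "e > 0"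
  shows "\<forall>\<^sub>F n in sequentially. \<forall>x\<in>V. norm (D n x) \<le> e * norm x"
proof -
  obtain B C where B: "finite B" and C: "\<And>x (L :: 'a \<Rightarrow> 'b). x \<in> V \<Longrightarrow> linear L \<Longrightarrow>
      norm (L x) \<le> C * (\<Sum>b\<in>B. norm (L b)) * norm x"
    using finite_dimensional_linear_bound[OF V, where 'b = 'b] by metis
  have "(\<lambda>n. C * (\<Sum>b\<in>B. norm (D n b))) \<longlonglongrightarrow> C * (\<Sum>b\<in>B. norm (0::'b))"
    by (intro tendsto_intros D)
  then have "\<forall>\<^sub>F n in sequentially. C * (\<Sum>b\<in>B. norm (D n b)) < e"
    using e by (intro order_tendstoD(2)) auto
  then show ?thesis
  proof eventually_elim
    case (elim n)
    then show ?case
      using C[OF _ bounded_linear.linear[OF blinfun.bounded_linear_right], of _ "D n"]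
      by (meson less_imp_le mult_right_mono norm_ge_zero order_trans)
  qed
qed

text \<open>Composing \<open>T n\<close> for large \<open>n\<close> with a left inverse of its restriction to \<open>F\<close> avoids
  extending functionals; the left inverse is bounded because the range of \<open>T n\<close> is finite-dimensional.\<close>

lemma finite_dimensional_projection:
  fixes T :: "nat \<Rightarrow> 'a::real_normed_vector \<Rightarrow>\<^sub>L 'a"
  assumes fin: "\<And>n. finite_dimensional (range (T n))" and T: "\<And>x. (\<lambda>n. T n x) \<longlonglongrightarrow> x"
    and F: "finite_dimensional F"
  obtains Q :: "'a \<Rightarrow>\<^sub>L 'a" where "range Q \<subseteq> F" "\<And>x. x \<in> F \<Longrightarrow> Q x = x"
proof -
  have "(\<lambda>n. (id_blinfun - T n) x) \<longlonglongrightarrow> 0" for x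
    using tendsto_diff[OF tendsto_const[of x] T[of x]] by (simp add: blinfun.diff_left)
  \<comment> \<open>Any factor below 1 would do: \<open>T n x = 0\<close> then forces
    \<open>norm x \<le> 1/2 * norm x\<close>, so \<open>T n\<close> is injective on
    \<open>F\<close>.\<close>
  then have "\<forall>\<^sub>F n in sequentially. \<forall>x\<in>F. norm ((id_blinfun - T n) x) \<le> 1/2 * norm x"
    by (intro strong_limit_uniform_on_finite_dimensional[OF F]) auto
  then obtain n where n: "\<And>x. x \<in> F \<Longrightarrow> norm ((id_blinfun - T n) x) \<le> 1/2 * norm x"
    using eventually_happens' sequentially_bot by blast
  have lin: "linear (T n)" by (simp add: blinfun.bounded_linear_right bounded_linear.linear)
  have sF: "subspace F" using F finite_dimensional_subspace by blast
  have "inj_on (T n) F"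
    unfolding linear_inj_on_iff_eq_0[OF lin sF]
    using n by (force simp: blinfun.diff_left)
  then obtain g where g: "range g \<subseteq> F" "linear g" "\<And>v. v \<in> F \<Longrightarrow> g (T n v) = v"
    using real_vector.linear_exists_left_inverse_on[OF lin sF]
    by blast
  obtain B C where C: "C \<ge> 0" "\<And>x (L :: 'a \<Rightarrow> 'a). x \<in> range (T n) \<Longrightarrow> linear L \<Longrightarrow>
      norm (L x) \<le> C * (\<Sum>b\<in>B. norm (L b)) * norm x"
    using finite_dimensional_linear_bound[OF fin, where 'b = 'a] by metis
  define K where "K = C * (\<Sum>b\<in>B. norm (g b))"
  have K: "K \<ge> 0" using C(1) by (simp add: K_def sum_nonneg)
  have bl: "bounded_linear (\<lambda>x. g (T n x))"
  proof (rule bounded_linear_intro[where K = "K * norm (T n)"])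
    fix x
    have "norm (g (T n x)) \<le> K * norm (T n x)" using C(2)[OF _ g(2)] by (simp add: K_def)
    also have "\<dots> \<le> K * (norm (T n) * norm x)" by (intro mult_left_mono norm_blinfun K)
    finally show "norm (g (T n x)) \<le> norm x * (K * norm (T n))" by (simp add: mult_ac)
  qed (auto simp: blinfun.add_right blinfun.scaleR_right linear_add[OF g(2)] linear_scale[OF g(2)])
  show thesis
    by (rule that[of "Blinfun (\<lambda>x. g (T n x))"]) (use g in \<open>auto simp: bounded_linear_Blinfun_apply[OF bl]\<close>)
qed

section \<open>Spaces with an unconditional decomposition\<close>

text \<open>A 1-unconditional decomposition seen through finite sums alone; independence of the
  \<open>F n\<close> and all facts on infinite series are consequences.\<close>

locale unconditional_family =
  fixes F :: "nat \<Rightarrow> 'b::banach set"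
  assumes fin_dim: "\<And>n. finite_dimensional (F n)"
    and unconditional: "\<And>N \<theta> g. sign_sequence \<theta> \<Longrightarrow> (\<And>i. g i \<in> F i) \<Longrightarrow>
      norm (\<Sum>i<N. \<theta> i *\<^sub>R g i) \<le> norm (\<Sum>i<N. g i)"
begin

text \<open>Convergent series are used in place of the closed span, so that coordinates are at hand;
  the price is a proof of closedness.\<close>

definition sum_space :: "'b set" where
  "sum_space = {y. \<exists>f. (\<forall>n. f n \<in> F n) \<and> f sums y}"

lemma subspace_F: "subspace (F n)"
  using fin_dim finite_dimensional_subspace by blast

text \<open>The sum over \<open>A\<close> is the mean of the full sum and of the sum with signs
  reversed off \<open>A\<close>.\<close>

lemma norm_sum_subset:
  assumes "\<And>i. g i \<in> F i" "A \<subseteq> {..<N}"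
  shows "norm (sum g A) \<le> norm (\<Sum>i<N. g i)"
proof -
  define \<theta> where "\<theta> i = (if i \<in> A then 1 else - 1 :: real)" for i :: nat
  have "sign_sequence \<theta>" by (simp add: sign_sequence_def \<theta>_def)
  then have le: "norm (\<Sum>i<N. \<theta> i *\<^sub>R g i) \<le> norm (\<Sum>i<N. g i)"
    using unconditional assms(1) by blast
  have "(\<Sum>i<N. g i) + (\<Sum>i<N. \<theta> i *\<^sub>R g i) = (\<Sum>i<N. if i \<in> A then 2 *\<^sub>R g i else 0)"
    unfolding sum.distrib[symmetric] by (intro sum.cong) (auto simp: \<theta>_def scaleR_2)
  also have "\<dots> = (\<Sum>i\<in>A. 2 *\<^sub>R g i)"
    using assms(2) by (simp add: sum.If_cases Int_absorb1)
  also have "\<dots> = 2 *\<^sub>R sum g A" by (simp add: scaleR_sum_right)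
  finally have "2 * norm (sum g A) = norm ((\<Sum>i<N. g i) + (\<Sum>i<N. \<theta> i *\<^sub>R g i))" by simp
  also have "\<dots> \<le> 2 * norm (\<Sum>i<N. g i)" using norm_triangle_ineq[of "\<Sum>i<N. g i" "\<Sum>i<N. \<theta> i *\<^sub>R g i"] le by linarith
  finally show ?thesis by simp
qed

lemma norm_partial_sum_le:
  assumes f: "\<And>i. f i \<in> F i" "f sums y" and "finite A"
  shows "norm (sum f A) \<le> norm y"
proof -
  obtain M where M: "A \<subseteq> {..<M}" using finite_nat_bounded[OF \<open>finite A\<close>] by blast
  have "(\<lambda>N. norm (\<Sum>i<N. f i)) \<longlonglongrightarrow> norm y"
    using f(2) by (intro tendsto_norm) (simp add: sums_def)
  moreover have "norm (sum f A) \<le> norm (\<Sum>i<N. f i)" if "N \<ge> M" for N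
    using M that by (intro norm_sum_subset f(1)) auto
  ultimately show ?thesis by (intro LIMSEQ_le_const) auto
qed

text \<open>Deleting the first \<open>N\<close> coordinates leaves an expansion of
  \<open>y - (\<Sum>i<N. f i)\<close>, to which the bound on partial sums applies.\<close>

lemma norm_tail_sum_le:
  assumes f: "\<And>i. f i \<in> F i" "f sums y" and "finite A" "A \<inter> {..<N} = {}"
  shows "norm (sum f A) \<le> norm (y - (\<Sum>i<N. f i))"
proof -
  let ?g = "\<lambda>i. f i - (if i \<in> {..<N} then f i else 0)"
  have "?g sums (y - (\<Sum>i<N. f i))"
    by (intro sums_diff f(2) sums_If_finite_set) simp
  moreover have "?g i \<in> F i" for i using f(1) subspace_0[OF subspace_F] by auto
  moreover have "sum ?g A = sum f A" using assms(4) by (intro sum.cong) auto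
  ultimately show ?thesis using norm_partial_sum_le[of ?g "y - (\<Sum>i<N. f i)" A] assms(3) by simp
qed

lemma coordinates_unique:
  assumes "\<And>i. f i \<in> F i" "f sums y" "\<And>i. g i \<in> F i" "g sums y"
  shows "f = g"
proof
  fix n
  have "(\<lambda>i. f i - g i) sums 0" using sums_diff[OF assms(2,4)] by simp
  then have "norm (\<Sum>i\<in>{n}. f i - g i) \<le> norm (0::'b)"
    by (intro norm_partial_sum_le subspace_diff[OF subspace_F] assms(1,3)) auto
  then show "f n = g n" by simp
qed

lemma subspace_sum_space: "subspace sum_space"
proof (rule subspaceI)
  show "0 \<in> sum_space"
    unfolding sum_space_def by (auto intro!: exI[of _ "\<lambda>_. 0"] subspace_0[OF subspace_F])
next
  fix x y assume "x \<in> sum_space" "y \<in> sum_space"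
  then obtain f g where "\<forall>n. f n \<in> F n" "f sums x" "\<forall>n. g n \<in> F n" "g sums y"
    unfolding sum_space_def by blast
  then show "x + y \<in> sum_space"
    unfolding sum_space_def
    by (auto intro!: exI[of _ "\<lambda>n. f n + g n"] sums_add subspace_add[OF subspace_F])
next
  fix c x assume "x \<in> sum_space"
  then obtain f where "\<forall>n. f n \<in> F n" "f sums x"
    unfolding sum_space_def by blast
  then show "c *\<^sub>R x \<in> sum_space"
    unfolding sum_space_def
    by (auto intro!: exI[of _ "\<lambda>n. c *\<^sub>R f n"] sums_scaleR_right subspace_scale[OF subspace_F])
qed

text \<open>Coordinates depend contractively on the sum, so they converge along a convergent
  sequence. The comparison of partial sums is uniform in \<open>N\<close>, which lets the limit
  coordinates sum to the limit.\<close>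

lemma closed_sum_space: "closed sum_space"
  unfolding closed_sequential_limits
proof (intro allI impI)
  fix y l assume "(\<forall>j. y j \<in> sum_space) \<and> y \<longlonglongrightarrow> l"
  then have y: "\<And>j. y j \<in> sum_space" and l: "y \<longlonglongrightarrow> l" by auto
  from y obtain f where f: "\<And>j n. f j n \<in> F n" "\<And>j. f j sums y j"
    unfolding sum_space_def mem_Collect_eq by metis
  have diff: "norm (\<Sum>i\<in>A. f j i - f k i) \<le> norm (y j - y k)" if "finite A" for j k A
    by (rule norm_partial_sum_le) (use f that in \<open>auto intro: sums_diff subspace_diff[OF subspace_F]\<close>)
  have "Cauchy (\<lambda>j. f j n)" for n
  proof (rule metric_CauchyI)
    fix e :: real assume "e > 0"
    then obtain M where "\<forall>j\<ge>M. \<forall>k\<ge>M. dist (y j) (y k) < e"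
      using metric_CauchyD[OF LIMSEQ_imp_Cauchy[OF l]] by blast
    moreover have "dist (f j n) (f k n) \<le> dist (y j) (y k)" for j k
      using diff[of "{n}" j k] by (simp add: dist_norm)
    ultimately show "\<exists>M. \<forall>j\<ge>M. \<forall>k\<ge>M. dist (f j n) (f k n) < e"
      by (meson le_less_trans)
  qed
  then have "\<forall>n. \<exists>g. (\<lambda>j. f j n) \<longlonglongrightarrow> g"
    using Cauchy_convergent_iff convergent_def by blast
  then obtain g where g: "\<And>n. (\<lambda>j. f j n) \<longlonglongrightarrow> g n" by metis
  have gF: "g n \<in> F n" for n
    using closed_sequentially[OF finite_dimensional_closed[OF fin_dim] f(1) g] .
  have lim: "norm (\<Sum>i<N. f j i - g i) \<le> norm (y j - l)" for N j
  proof (rule LIMSEQ_le)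
    show "(\<lambda>k. norm (\<Sum>i<N. f j i - f k i)) \<longlonglongrightarrow> norm (\<Sum>i<N. f j i - g i)"
      by (intro tendsto_intros g)
    show "(\<lambda>k. norm (y j - y k)) \<longlonglongrightarrow> norm (y j - l)" by (intro tendsto_intros l)
  qed (use diff in auto)
  have "g sums l"
    unfolding sums_def
  proof (rule metric_LIMSEQ_I)
    fix e :: real assume e: "e > 0"
    then obtain j where j: "dist (y j) l < e / 3"
      using metric_LIMSEQ_D[OF l, of "e / 3"] by auto
    obtain M where M: "\<And>N. N \<ge> M \<Longrightarrow> dist (\<Sum>i<N. f j i) (y j) < e / 3"
      using metric_LIMSEQ_D[OF f(2)[of j, unfolded sums_def], of "e / 3"] e by auto
    have "dist (\<Sum>i<N. g i) l < e" if "N \<ge> M" for N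
    proof -
      have "dist (\<Sum>i<N. g i) (\<Sum>i<N. f j i) \<le> dist (y j) l"
        using lim[where N = N and j = j] by (simp add: dist_norm sum_subtractf norm_minus_commute)
      then show ?thesis
        using j M[OF that] dist_triangle[of "\<Sum>i<N. g i" l "\<Sum>i<N. f j i"]
          dist_triangle[of "\<Sum>i<N. f j i" l "y j"] by linarith
    qed
    then show "\<exists>M. \<forall>N\<ge>M. dist (\<Sum>i<N. g i) l < e" by blast
  qed
  then show "l \<in> sum_space" using gF unfolding sum_space_def by blast
qed

lemma banach_subspace_sum_space: "banach_subspace sum_space"
  by (simp add: banach_subspace_def subspace_sum_space closed_sum_space)

lemma F_subset_sum_space: "F n \<subseteq> sum_space"
proof
  fix x assume "x \<in> F n"
  then have "\<forall>i. (if i = n then x else 0) \<in> F i" using subspace_0[OF subspace_F] by auto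
  moreover have "(\<lambda>i. if i = n then x else 0) sums x" using sums_single[of n "\<lambda>_. x"] by simp
  ultimately show "x \<in> sum_space"
    unfolding sum_space_def mem_Collect_eq by (intro exI[of _ "\<lambda>i. if i = n then x else 0"] conjI)
qed

text \<open>The tail bound is uniform over all finite index sets beyond \<open>N\<close>, which is
  convergence along the net.\<close>

lemma summable_on_coordinates:
  assumes f: "\<And>i. f i \<in> F i" "f sums y"
  shows "f summable_on UNIV"
proof -
  have "(f has_sum y) UNIV"
    unfolding has_sum_def tendsto_iff eventually_finite_subsets_at_top
  proof (intro allI impI)
    fix e :: real assume "e > 0"
    then obtain N where N: "dist (\<Sum>i<N. f i) y < e / 2"
      using metric_LIMSEQ_D[OF f(2)[unfolded sums_def], of "e / 2"] by auto
    have "dist (sum f A) y < e" if A: "finite A" "{..<N} \<subseteq> A" for A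
    proof -
      have "sum f A = (\<Sum>i<N. f i) + sum f (A - {..<N})"
        using A by (simp add: sum.subset_diff add.commute)
      then have "dist (sum f A) (\<Sum>i<N. f i) = norm (sum f (A - {..<N}))" by (simp add: dist_norm)
      also have "\<dots> \<le> norm (y - (\<Sum>i<N. f i))" using A by (intro norm_tail_sum_le f) auto
      finally have "dist (sum f A) (\<Sum>i<N. f i) < e / 2"
        using N by (simp add: dist_norm norm_minus_commute)
      then show ?thesis using N dist_triangle[of "sum f A" y "\<Sum>i<N. f i"] by linarith
    qed
    then show "\<exists>X. finite X \<and> X \<subseteq> UNIV \<and>
        (\<forall>Y. finite Y \<and> X \<subseteq> Y \<and> Y \<subseteq> UNIV \<longrightarrow> dist (sum f Y) y < e)"
      by (intro exI[of _ "{..<N}"]) auto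
  qed
  then show ?thesis by (rule has_sum_imp_summable)
qed

text \<open>\<open>F\<close> itself serves for every \<delta>, the constant being exactly 1.
  Convergence of the signed series is proved first, because its \<open>suminf\<close> is meaningful
  only then.\<close>

lemma has_UFDD_sum_space: "has_UFDD sum_space 1"
  unfolding has_UFDD_def
proof (intro allI impI exI[of _ F] conjI ballI)
  show "UFDD sum_space F"
    unfolding UFDD_def
  proof (intro conjI ballI allI impI)
    fix y assume "y \<in> sum_space"
    then obtain f where "\<forall>n. f n \<in> F n" "f sums y" unfolding sum_space_def by blast
    then show "\<exists>!f. (\<forall>n. f n \<in> F n) \<and> f sums y"
      using coordinates_unique by (intro ex1I[of _ f]) blast+
  next
    fix y f assume "(\<forall>n. f n \<in> F n) \<and> f sums y"
    then show "f summable_on UNIV" using summable_on_coordinates by blast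
  qed (fact F_subset_sum_space fin_dim)+
next
  fix \<delta> :: real and y f and \<theta> :: "nat \<Rightarrow> real"
  assume \<delta>: "\<delta> > 0" and "(\<forall>n. f n \<in> F n) \<and> f sums y" and \<theta>: "sign_sequence \<theta>"
  then have f: "\<And>n. f n \<in> F n" "f sums y" by auto
  have "summable (\<lambda>n. \<theta> n *\<^sub>R f n)"
    unfolding summable_Cauchy
  proof (intro allI impI)
    fix e :: real assume "e > 0"
    then obtain N where N: "dist (\<Sum>i<N. f i) y < e / 2"
      using metric_LIMSEQ_D[OF f(2)[unfolded sums_def], of "e / 2"] by auto
    have "norm (\<Sum>i=m..<n. \<theta> i *\<^sub>R f i) < e" if "m \<ge> N" for m n
    proof -
      \<comment> \<open>Unconditionality concerns initial segments, so the block is padded with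
        zeros.\<close>
      let ?g = "\<lambda>i. if i \<in> {m..<n} then f i else 0"
      have "(\<Sum>i=m..<n. \<theta> i *\<^sub>R f i) = (\<Sum>i<n. \<theta> i *\<^sub>R ?g i)"
        by (intro sum.mono_neutral_cong_left) auto
      also have "norm \<dots> \<le> norm (\<Sum>i<n. ?g i)"
        using f(1) subspace_0[OF subspace_F] by (intro unconditional \<theta>) auto
      also have "(\<Sum>i<n. ?g i) = (\<Sum>i=m..<n. f i)"
        by (intro sum.mono_neutral_cong_right) auto
      also have "norm \<dots> \<le> norm (y - (\<Sum>i<N. f i))" using that by (intro norm_tail_sum_le f) auto
      also have "\<dots> < e" using N \<open>e > 0\<close> by (simp add: dist_norm norm_minus_commute)
      finally show ?thesis .
    qed
    then show "\<exists>N. \<forall>m\<ge>N. \<forall>n. norm (\<Sum>i=m..<n. \<theta> i *\<^sub>R f i) < e" by blast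
  qed
  then have "(\<lambda>N. norm (\<Sum>i<N. \<theta> i *\<^sub>R f i)) \<longlonglongrightarrow> norm (\<Sum>n. \<theta> n *\<^sub>R f n)"
    by (intro tendsto_norm) (simp add: summable_LIMSEQ)
  moreover have "norm (\<Sum>i<N. \<theta> i *\<^sub>R f i) \<le> norm y" for N
    using unconditional[OF \<theta> f(1), of N] norm_partial_sum_le[OF f, of "{..<N}"] by simp
  ultimately have "norm (\<Sum>n. \<theta> n *\<^sub>R f n) \<le> norm y" by (intro LIMSEQ_le_const2) auto
  also have "\<dots> \<le> (1 + \<delta>) * norm y" using \<delta> by (simp add: mult_le_cancel_right1)
  finally show "norm (\<Sum>n. \<theta> n *\<^sub>R f n) \<le> (1 + \<delta>) * norm y" .
qed

end

section \<open>Perturbation to an approximating sequence\<close>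

text \<open>Repeating \<open>\<theta> i\<close> for all j with
  \<open>m i \<le> j < m (Suc i)\<close> makes each block telescope, so a subsequence inherits the
  bound on signed sums.\<close>

lemma sum_block_signs:
  fixes T :: "nat \<Rightarrow> 'a::real_vector"
  assumes m: "strict_mono m" "m 0 = 0" and \<theta>: "sign_sequence \<theta>"
  shows "\<exists>\<theta>'. sign_sequence \<theta>' \<and>
    (\<Sum>i<N. \<theta> i *\<^sub>R (T (m (Suc i)) - T (m i))) = (\<Sum>j<m N. \<theta>' j *\<^sub>R (T (Suc j) - T j))"
proof (induction N)
  case 0
  then show ?case using m(2) \<theta> by auto
next
  case (Suc N)
  then obtain \<theta>' where t: "sign_sequence \<theta>'"
    "(\<Sum>i<N. \<theta> i *\<^sub>R (T (m (Suc i)) - T (m i))) = (\<Sum>j<m N. \<theta>' j *\<^sub>R (T (Suc j) - T j))" by blast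
  define \<theta>2 where "\<theta>2 j = (if j < m N then \<theta>' j else \<theta> N)" for j
  have le: "m N \<le> m (Suc N)" using m(1) by (simp add: strict_mono_Suc_iff less_imp_le)
  have "(\<Sum>j<m (Suc N). \<theta>2 j *\<^sub>R (T (Suc j) - T j)) =
      (\<Sum>j<m N. \<theta>2 j *\<^sub>R (T (Suc j) - T j)) + (\<Sum>j=m N..<m (Suc N). \<theta>2 j *\<^sub>R (T (Suc j) - T j))"
    using le sum.atLeastLessThan_concat[of 0 "m N" "m (Suc N)" "\<lambda>j. \<theta>2 j *\<^sub>R (T (Suc j) - T j)"]
    by (simp add: atLeast0LessThan)
  also have "(\<Sum>j<m N. \<theta>2 j *\<^sub>R (T (Suc j) - T j)) = (\<Sum>j<m N. \<theta>' j *\<^sub>R (T (Suc j) - T j))"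
    by (intro sum.cong) (auto simp: \<theta>2_def)
  also have "(\<Sum>j=m N..<m (Suc N). \<theta>2 j *\<^sub>R (T (Suc j) - T j)) =
      (\<Sum>j=m N..<m (Suc N). \<theta> N *\<^sub>R (T (Suc j) - T j))"
    by (intro sum.cong) (auto simp: \<theta>2_def)
  also have "\<dots> = \<theta> N *\<^sub>R (T (m (Suc N)) - T (m N))"
    using sum_Suc_diff'[OF le, of T] by (simp add: scaleR_sum_right[symmetric])
  finally have "(\<Sum>i<Suc N. \<theta> i *\<^sub>R (T (m (Suc i)) - T (m i))) = (\<Sum>j<m (Suc N). \<theta>2 j *\<^sub>R (T (Suc j) - T j))"
    using t(2) by simp
  moreover have "sign_sequence \<theta>2" using t(1) \<theta> by (auto simp: sign_sequence_def \<theta>2_def)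
  ultimately show ?case by blast
qed

lemma sum_half_powers_le: "(\<Sum>i<N. (1/2::real) ^ Suc i) \<le> 1"
proof -
  have "(\<Sum>i<N. (1/2::real) ^ Suc i) = 1 - (1/2) ^ N" by (induction N) auto
  then show ?thesis by simp
qed

text \<open>The correction \<open>S = T n + (I - T n) Q\<close>, with \<open>Q\<close> a projection onto the range of the
  operator chosen before, acts as the identity on that range and is close to \<open>T n\<close> for large \<open>n\<close>.\<close>

lemma approximating_sequence_perturbation:
  fixes T :: "nat \<Rightarrow> 'a::real_normed_vector \<Rightarrow>\<^sub>L 'a"
  assumes T0: "T 0 = 0" and fin: "\<And>n. finite_dimensional (range (T n))"
    and T: "\<And>x. (\<lambda>n. T n x) \<longlonglongrightarrow> x"
    and K: "\<And>\<theta> N. sign_sequence \<theta> \<Longrightarrow> norm (\<Sum>i<N. \<theta> i *\<^sub>R (T (Suc i) - T i)) \<le> K"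
    and \<eta>: "\<eta> > 0"
  shows "\<exists>S :: nat \<Rightarrow> 'a \<Rightarrow>\<^sub>L 'a. approximating_sequence S \<and>
    (\<forall>\<theta> N. sign_sequence \<theta> \<longrightarrow> norm (\<Sum>i=1..N. \<theta> i *\<^sub>R increment S i) \<le> K + \<eta>)"
proof -
  \<comment> \<open>Chosen so that the sum of all \<open>e (Suc i) + e i\<close>, being at most the
    sum of \<open>2 * e i\<close>, stays below \<eta>.\<close>
  define e where "e k = \<eta> / 2 * (1/2) ^ Suc k" for k
  have e_pos: "e k > 0" for k using \<eta> by (simp add: e_def)
  \<comment> \<open>The state is an index together with the corrected operator. Starting at (0, 0)
    makes the first increment a difference like the others and lets the blocks begin at index
    0.\<close>
  let ?P = "\<lambda>k (n, S). finite_dimensional (range (blinfun_apply S)) \<and> norm (S - T n) \<le> e k \<and> (k = 0 \<longrightarrow> n = 0 \<and> S = 0)"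
  let ?Q = "\<lambda>k (n, S) (n', S'). (n::nat) < n' \<and> S' o\<^sub>L S = S"
  have "\<exists>f. \<forall>k. ?P k (f k) \<and> ?Q k (f k) (f (Suc k))"
  proof (rule dependent_nat_choice)
    have "finite_dimensional (range (blinfun_apply (0 :: 'a \<Rightarrow>\<^sub>L 'a)))" using fin[of 0] T0 by simp
    then show "\<exists>p. ?P 0 p" using T0 e_pos[of 0] by (intro exI[of _ "(0, 0)"]) auto
  next
    fix p k assume "?P k p"
    then obtain n S where p: "p = (n, S)" and S: "finite_dimensional (range (blinfun_apply S))" by (cases p) auto
    obtain R where R: "range (blinfun_apply R) \<subseteq> range S" "\<And>x. x \<in> range S \<Longrightarrow> blinfun_apply R x = x"
      using finite_dimensional_projection[OF fin T S] by blast
    \<comment> \<open>The correction will have norm at most \<open>d * norm R\<close>; adding 1 in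
      the denominator covers \<open>R = 0\<close>.\<close>
    define d where "d = e (Suc k) / (1 + norm R)"
    have pos: "1 + norm R > 0" by (simp add: add_pos_nonneg)
    have d: "d > 0" using e_pos pos by (simp add: d_def)
    have "d * (1 + norm R) = e (Suc k)" using pos by (simp add: d_def)
    then have dR: "d * norm R \<le> e (Suc k)" using d by (simp add: distrib_left)
    have "(\<lambda>n. (id_blinfun - T n) x) \<longlonglongrightarrow> 0" for x
      using tendsto_diff[OF tendsto_const[of x] T[of x]] by (simp add: blinfun.diff_left)
    then have "\<forall>\<^sub>F j in sequentially. \<forall>x\<in>range S. norm ((id_blinfun - T j) x) \<le> d * norm x"
      by (intro strong_limit_uniform_on_finite_dimensional[OF S] d)
    then have "\<forall>\<^sub>F j in sequentially. (\<forall>x\<in>range S. norm ((id_blinfun - T j) x) \<le> d * norm x) \<and> n < j"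
      using eventually_gt_at_top[of n] by (rule eventually_conj)
    then obtain j where j: "n < j" "\<And>x. x \<in> range S \<Longrightarrow> norm ((id_blinfun - T j) x) \<le> d * norm x"
      using eventually_happens' sequentially_bot by blast
    define S' where "S' = T j + ((id_blinfun - T j) o\<^sub>L R)"
    have "finite_dimensional (range (blinfun_apply ((id_blinfun - T j) o\<^sub>L R)))"
    proof -
      obtain B where B: "finite B" "range (blinfun_apply S) = span B" using S unfolding finite_dimensional_def by blast
      have "finite_dimensional (range (blinfun_apply R))"
        using R(1) B by (intro finite_dimensional_subset[of _ B] linear_subspace_image
            blinfun.bounded_linear_right bounded_linear.linear subspace_UNIV) auto
      then have "finite_dimensional (blinfun_apply (id_blinfun - T j) ` range (blinfun_apply R))"
        by (rule finite_dimensional_image[OF bounded_linear.linear[OF blinfun.bounded_linear_right]])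
      then show ?thesis by (simp add: image_image)
    qed
    then have "finite_dimensional (range (blinfun_apply S'))"
      unfolding S'_def by (intro finite_dimensional_range_add fin)
    moreover have "norm (S' - T j) \<le> e (Suc k)"
    proof -
      have "norm ((id_blinfun - T j) o\<^sub>L R) \<le> d * norm R"
      proof (rule norm_blinfun_bound)
        fix x
        have "norm ((id_blinfun - T j) (R x)) \<le> d * norm (R x)" using j(2) R(1) by blast
        also have "\<dots> \<le> d * (norm R * norm x)" using d by (intro mult_left_mono norm_blinfun) auto
        finally show "norm (((id_blinfun - T j) o\<^sub>L R) x) \<le> d * norm R * norm x" by simp
      qed (use d in simp)
      then show ?thesis using dR by (simp add: S'_def)
    qed
    moreover have "S' o\<^sub>L S = S"
      by (rule blinfun_eqI) (simp add: S'_def R(2) blinfun.add_left blinfun.diff_left)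
    ultimately show "\<exists>p'. ?P (Suc k) p' \<and> ?Q k p p'"
      using j(1) p by (intro exI[of _ "(j, S')"]) auto
  qed
  then obtain f where f: "\<forall>k. ?P k (f k) \<and> ?Q k (f k) (f (Suc k))" by (rule exE)
  define m where "m k = fst (f k)" for k
  define S where "S k = snd (f k)" for k
  have f_eq: "f k = (m k, S k)" for k by (simp add: m_def S_def)
  have S: "finite_dimensional (range (S k))" "norm (S k - T (m k)) \<le> e k" "m k < m (Suc k)" "S (Suc k) o\<^sub>L S k = S k" for k
    using f[rule_format, of k] unfolding f_eq prod.case by blast+
  have S0: "m 0 = 0" "S 0 = 0" using f[rule_format, of 0] unfolding f_eq prod.case by blast+
  have mono: "strict_mono m" using S(3) by (simp add: strict_mono_Suc_iff)
  \<comment> \<open>The recursion gives the relation for neighbours only; it spreads by inserting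
    \<open>S i\<close> with \<open>j = Suc i\<close>.\<close>
  have comp: "S j o\<^sub>L S n = S n" if "n < j" for n j
    using that
  proof (induction j rule: less_induct)
    case (less j)
    then obtain i where i: "j = Suc i" "n \<le> i" by (cases j) auto
    show ?case
    proof (cases "n = i")
      case True
      then show ?thesis using S(4) i by simp
    next
      case False
      then have eq: "S i o\<^sub>L S n = S n" using less i by simp
      have "S j o\<^sub>L (S i o\<^sub>L S n) = (S j o\<^sub>L S i) o\<^sub>L S n" by (rule blinfun_eqI) simp
      then show ?thesis using eq S(4)[of i] i(1) by simp
    qed
  qed
  have e_lim: "e \<longlonglongrightarrow> 0"
  proof -
    have "(\<lambda>k. \<eta> / 2 * (1/2) ^ Suc k) \<longlonglongrightarrow> \<eta> / 2 * 0"
      by (intro tendsto_mult_left LIMSEQ_Suc LIMSEQ_realpow_zero) auto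
    then show ?thesis unfolding e_def by simp
  qed
  have "(\<lambda>k. S k x) \<longlonglongrightarrow> x" for x
  proof -
    have "(\<lambda>k. (S k - T (m k)) x) \<longlonglongrightarrow> 0"
    proof (rule Lim_null_comparison)
      show "\<forall>\<^sub>F k in sequentially. norm ((S k - T (m k)) x) \<le> e k * norm x"
        using S(2) by (intro always_eventually allI order_trans[OF norm_blinfun] mult_right_mono) auto
      show "(\<lambda>k. e k * norm x) \<longlonglongrightarrow> 0" using tendsto_mult_left_zero[OF e_lim] .
    qed
    from tendsto_add[OF this LIMSEQ_subseq_LIMSEQ[OF T mono, of x]]
    show ?thesis by (simp add: blinfun.diff_left o_def)
  qed
  then have approx: "approximating_sequence S"
    unfolding approximating_sequence_def using S(1) comp by blast
  have bound: "norm (\<Sum>i=1..N. \<theta> i *\<^sub>R increment S i) \<le> K + \<eta>" if \<theta>: "sign_sequence \<theta>" for \<theta> N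
  proof -
    let ?s = "\<lambda>i. \<theta> (Suc i)"
    let ?D = "\<lambda>i. S i - T (m i)"
    have inc: "increment S (Suc i) = S (Suc i) - S i" for i using S0 by (auto simp: increment_def)
    have s: "sign_sequence ?s" using \<theta> by (simp add: sign_sequence_def)
    have abs: "\<bar>?s i\<bar> = 1" for i using s by (auto simp: sign_sequence_def dest: spec[of _ i])
    have "(\<Sum>i=1..N. \<theta> i *\<^sub>R increment S i) = (\<Sum>i<N. ?s i *\<^sub>R increment S (Suc i))"
      by (rule sum.reindex_bij_witness[of _ Suc "\<lambda>i. i - 1"]) auto
    also have "\<dots> = (\<Sum>i<N. ?s i *\<^sub>R (T (m (Suc i)) - T (m i))) + (\<Sum>i<N. ?s i *\<^sub>R (?D (Suc i) - ?D i))"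
      unfolding sum.distrib[symmetric] inc by (intro sum.cong) (auto simp: algebra_simps)
    also have "norm \<dots> \<le> K + (\<Sum>i<N. e (Suc i) + e i)"
    proof (rule norm_triangle_mono)
      obtain \<theta>' where "sign_sequence \<theta>'"
        "(\<Sum>i<N. ?s i *\<^sub>R (T (m (Suc i)) - T (m i))) = (\<Sum>j<m N. \<theta>' j *\<^sub>R (T (Suc j) - T j))"
        using sum_block_signs[OF mono S0(1) s] by blast
      then show "norm (\<Sum>i<N. ?s i *\<^sub>R (T (m (Suc i)) - T (m i))) \<le> K" using K by metis
      show "norm (\<Sum>i<N. ?s i *\<^sub>R (?D (Suc i) - ?D i)) \<le> (\<Sum>i<N. e (Suc i) + e i)"
      proof (rule sum_norm_le)
        fix i
        have "norm (?D (Suc i) - ?D i) \<le> e (Suc i) + e i"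
          using norm_triangle_ineq4[of "?D (Suc i)" "?D i"] S(2)[of i] S(2)[of "Suc i"] by linarith
        then show "norm (?s i *\<^sub>R (?D (Suc i) - ?D i)) \<le> e (Suc i) + e i" using abs by simp
      qed
    qed
    also have "(\<Sum>i<N. e (Suc i) + e i) \<le> (\<Sum>i<N. 2 * e i)"
      using \<eta> by (intro sum_mono) (simp add: e_def)
    also have "\<dots> = \<eta> * (\<Sum>i<N. (1/2) ^ Suc i)" by (simp add: e_def sum_distrib_left mult_ac)
    also have "\<dots> \<le> \<eta>" using sum_half_powers_le[of N] \<eta> by (simp add: mult_le_cancel_left1)
    finally show ?thesis by simp
  qed
  show ?thesis using approx bound by blast
qed

section \<open>Complemented subspaces have the UBAP\<close>

text \<open>Linearity of the coordinates comes from uniqueness of the expansion.\<close>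

lemma UFDD_coordinates_linear:
  assumes E: "UFDD Y E" and Y: "subspace Y"
  obtains c where "\<And>y n. y \<in> Y \<Longrightarrow> c y n \<in> E n" "\<And>y. y \<in> Y \<Longrightarrow> c y sums y"
    "\<And>x y n. x \<in> Y \<Longrightarrow> y \<in> Y \<Longrightarrow> c (x + y) n = c x n + c y n"
    "\<And>r x n. x \<in> Y \<Longrightarrow> c (r *\<^sub>R x) n = r *\<^sub>R c x n"
proof -
  define c where "c y = (THE f. (\<forall>n. f n \<in> E n) \<and> f sums y)" for y
  have ex: "\<exists>!f. (\<forall>n. f n \<in> E n) \<and> f sums y" if "y \<in> Y" for y
    using E that unfolding UFDD_def by blast
  have c: "(\<forall>n. c y n \<in> E n) \<and> c y sums y" if "y \<in> Y" for y
    unfolding c_def by (rule theI'[OF ex[OF that]])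
  have uniq: "c y = f" if "y \<in> Y" "\<forall>n. f n \<in> E n" "f sums y" for y f
    using ex[OF that(1)] c[OF that(1)] that by blast
  have sE: "subspace (E n)" for n
    using E finite_dimensional_subspace unfolding UFDD_def by blast
  have "c (x + y) = (\<lambda>n. c x n + c y n)" if "x \<in> Y" "y \<in> Y" for x y
    using c[OF that(1)] c[OF that(2)]
    by (intro uniq subspace_add[OF Y] that) (auto intro: subspace_add[OF sE] sums_add)
  moreover have "c (r *\<^sub>R x) = (\<lambda>n. r *\<^sub>R c x n)" if "x \<in> Y" for r x
    using c[OF that]
    by (intro uniq subspace_scale[OF Y] that) (auto intro: subspace_scale[OF sE] sums_scaleR_right)
  ultimately show thesis using c by (intro that[of c]) auto
qed

text \<open>A sign pattern cut off at \<open>N\<close> is the mean of its extensions by \<open>1\<close> and by \<open>-1\<close>; both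
  extensions are eventually constant, so the signed series converge without further argument.\<close>

lemma signed_partial_sum_le:
  fixes f :: "nat \<Rightarrow> 'b::real_normed_vector"
  assumes f: "f sums y" and \<theta>: "sign_sequence \<theta>"
    and K: "\<And>\<theta>. sign_sequence \<theta> \<Longrightarrow> norm (\<Sum>n. \<theta> n *\<^sub>R f n) \<le> K"
  shows "norm (\<Sum>i<N. \<theta> i *\<^sub>R f i) \<le> K"
proof -
  define s where "s = (\<Sum>i<N. \<theta> i *\<^sub>R f i)"
  define t where "t = y - (\<Sum>i<N. f i)"
  have ext: "norm (s + r *\<^sub>R t) \<le> K" if r: "r = 1 \<or> r = -1" for r
  proof -
    let ?\<theta> = "\<lambda>i. if i < N then \<theta> i else r"
    have "(\<lambda>i. r *\<^sub>R f i + (if i \<in> {..<N} then \<theta> i *\<^sub>R f i - r *\<^sub>R f i else 0))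
        sums (r *\<^sub>R y + (\<Sum>i<N. \<theta> i *\<^sub>R f i - r *\<^sub>R f i))"
      by (intro sums_add sums_scaleR_right f sums_If_finite_set) simp
    moreover have "(\<lambda>i. r *\<^sub>R f i + (if i \<in> {..<N} then \<theta> i *\<^sub>R f i - r *\<^sub>R f i else 0)) =
        (\<lambda>i. ?\<theta> i *\<^sub>R f i)" by auto
    moreover have "r *\<^sub>R y + (\<Sum>i<N. \<theta> i *\<^sub>R f i - r *\<^sub>R f i) = s + r *\<^sub>R t"
      by (simp add: s_def t_def sum_subtractf scaleR_sum_right[symmetric] algebra_simps)
    ultimately have "(\<Sum>i. ?\<theta> i *\<^sub>R f i) = s + r *\<^sub>R t" by (simp add: sums_iff)
    moreover have "sign_sequence ?\<theta>" using \<theta> r by (auto simp: sign_sequence_def)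
    ultimately show ?thesis using K by metis
  qed
  have "2 * norm s = norm ((s + 1 *\<^sub>R t) + (s + (-1) *\<^sub>R t))"
    by (simp flip: scaleR_2)
  also have "\<dots> \<le> K + K" by (intro norm_triangle_mono ext) auto
  finally show ?thesis by (simp add: s_def)
qed

text \<open>Meant for a map that is linear on \<open>Y\<close> only and arbitrary elsewhere; it
  yields the finite rank of the compressed partial sums.\<close>

lemma linear_on_subspace_span:
  assumes Y: "subspace Y" and B: "B \<subseteq> Y" and y: "y \<in> span B"
    and add: "\<And>x y. x \<in> Y \<Longrightarrow> y \<in> Y \<Longrightarrow> R (x + y) = R x + R y"
    and scale: "\<And>c x. x \<in> Y \<Longrightarrow> R (c *\<^sub>R x) = c *\<^sub>R R x"
  shows "R y \<in> span (R ` B)"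
proof -
  have Y0: "0 \<in> Y" using Y subspace_0 by blast
  \<comment> \<open>Membership in \<open>Y\<close> is carried through the induction because
    additivity holds only there.\<close>
  have "y \<in> Y \<and> R y \<in> span (R ` B)"
    using y
  proof (induction y rule: span_induct_alt)
    case base
    then show ?case using scale[OF Y0, of 0] Y0 span_zero by simp
  next
    case (step c x y)
    then have "x \<in> Y" "c *\<^sub>R x \<in> Y" using B Y subspace_scale by blast+
    then have eq: "R (c *\<^sub>R x + y) = c *\<^sub>R R x + R y" and "c *\<^sub>R x + y \<in> Y"
      using step add scale subspace_add[OF Y] by auto
    moreover have "c *\<^sub>R R x + R y \<in> span (R ` B)"
      using step by (intro span_add span_scale) (auto intro: span_base)
    ultimately show ?case by simp
  qed
  then show ?thesis by blast
qed

lemma UBAP_if_complemented: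
  assumes lam: "lam \<ge> 1"
    and emb: "\<And>\<epsilon>. \<epsilon> > 0 \<Longrightarrow> \<exists>Y :: 'b::banach set. banach_subspace Y \<and> has_UFDD Y 1 \<and>
       embeds_complemented TYPE('a::banach) (lam + \<epsilon>) Y"
  shows "has_UBAP TYPE('a) lam"
  unfolding has_UBAP_def
proof (intro allI impI)
  fix \<epsilon> :: real assume \<epsilon>: "\<epsilon> > 0"
  \<comment> \<open>The loss \<epsilon> is split into \<epsilon>/4 for the embedding, \<epsilon>/2
    for the decomposition (\<open>c * \<delta>\<close>) and \<epsilon>/4 for the
    perturbation.\<close>
  define c where "c = lam + \<epsilon> / 4"
  define \<delta> where "\<delta> = (\<epsilon> / 2) / c"
  have c: "c \<ge> 1" using lam \<epsilon> by (simp add: c_def)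
  have \<delta>: "\<delta> > 0" using \<epsilon> c by (simp add: \<delta>_def)
  obtain Y :: "'b set" where Y: "subspace Y" "has_UFDD Y 1" "embeds_complemented TYPE('a) c Y"
    using emb[of "\<epsilon> / 4"] \<epsilon> unfolding c_def banach_subspace_def by auto
  obtain E where E: "UFDD Y E"
    and bound: "\<And>y f \<theta>. y \<in> Y \<Longrightarrow> (\<And>n. f n \<in> E n) \<Longrightarrow> f sums y \<Longrightarrow> sign_sequence \<theta> \<Longrightarrow>
      norm (\<Sum>n. \<theta> n *\<^sub>R f n) \<le> (1 + \<delta>) * norm y"
    using Y(2) \<delta> unfolding has_UFDD_def by meson
  obtain J :: "'a \<Rightarrow> 'b" and P where J: "isomorphic_embedding J"
    and P: "projection_bounded_by c Y (range J) P"
    and JP: "\<And>y x. y \<in> Y \<Longrightarrow> P y = J x \<Longrightarrow> onorm J * norm x \<le> c * norm y"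
    using Y(3) unfolding embeds_complemented_def by blast
  have blJ: "bounded_linear J" using J unfolding isomorphic_embedding_def by blast
  then have linJ: "linear J" by (simp add: bounded_linear.linear)
  obtain a where a: "a > 0" "\<And>x. a * norm x \<le> norm (J x)"
    using J unfolding isomorphic_embedding_def by blast
  have inj: "x = x'" if "J x = J x'" for x x'
    using a(2)[of "x - x'"] a(1) that by (simp add: linear_diff[OF linJ] mult_le_0_iff)
  have PY: "\<And>y. y \<in> Y \<Longrightarrow> P y \<in> range J" "linear_into Y (range J) P" "\<And>y. y \<in> Y \<Longrightarrow> norm (P y) \<le> c * norm y"
    and PJ: "\<And>x. P (J x) = J x" and JY: "\<And>x. J x \<in> Y"
    using P unfolding projection_bounded_by_def linear_into_def by auto
  \<comment> \<open>The inverse of \<open>J\<close> after \<open>P\<close>. Its linearity on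
    \<open>Y\<close> is read off from \<open>J (R y) = P y\<close> and injectivity of
    \<open>J\<close>.\<close>
  define R where "R y = inv J (P y)" for y
  have JR: "J (R y) = P y" if "y \<in> Y" for y unfolding R_def using PY(1)[OF that] by (rule f_inv_into_f)
  have RJ: "R (J x) = x" for x using JR[OF JY] PJ inj by metis
  have R: "linear_into Y UNIV (\<lambda>y. J (R y))"
    using PY(2) JR subspace_add[OF Y(1)] subspace_scale[OF Y(1)] unfolding linear_into_def by simp
  have R_add: "R (x + y) = R x + R y" if "x \<in> Y" "y \<in> Y" for x y
    using R that inj[of "R (x + y)" "R x + R y"] unfolding linear_into_def by (simp add: linear_add[OF linJ])
  have R_scale: "R (r *\<^sub>R x) = r *\<^sub>R R x" if "x \<in> Y" for x r
    using R that inj[of "R (r *\<^sub>R x)" "r *\<^sub>R R x"] unfolding linear_into_def by (simp add: linear_scale[OF linJ])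
  have R0: "R 0 = 0" using R_scale[OF JY, of 0] by simp
  have R_sum: "R (sum f A) = (\<Sum>i\<in>A. R (f i))" if "\<And>i. f i \<in> Y" for f :: "nat \<Rightarrow> 'b" and A
    by (induction A rule: infinite_finite_induct) (auto simp: R0 R_add that subspace_sum[OF Y(1)])
  have R_diff: "R (x - y) = R x - R y" if "x \<in> Y" "y \<in> Y" for x y
    using R_add[of x "- y"] R_scale[of y "-1"] that subspace_neg[OF Y(1)] by simp
  \<comment> \<open>This crude bound serves only for the convergence of \<open>T n x\<close>, where
    the constant is immaterial.\<close>
  have R_bound: "a * norm (R y) \<le> c * norm y" if "y \<in> Y" for y
    using a(2)[of "R y"] JR[OF that] PY(3)[OF that] by simp
  obtain q where q: "\<And>y n. y \<in> Y \<Longrightarrow> q y n \<in> E n" "\<And>y. y \<in> Y \<Longrightarrow> q y sums y"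
    "\<And>x y n. x \<in> Y \<Longrightarrow> y \<in> Y \<Longrightarrow> q (x + y) n = q x n + q y n"
    "\<And>r x n. x \<in> Y \<Longrightarrow> q (r *\<^sub>R x) n = r *\<^sub>R q x n"
    using UFDD_coordinates_linear[OF E Y(1)] by blast
  have EY: "E n \<subseteq> Y" "finite_dimensional (E n)" for n using E unfolding UFDD_def by blast+
  have qY: "q (J x) n \<in> Y" for x n using q(1)[OF JY] EY(1) by blast
  have signed: "norm (\<Sum>i<N. \<theta> i *\<^sub>R q (J x) i) \<le> (1 + \<delta>) * norm (J x)" if "sign_sequence \<theta>" for \<theta> N x
    using q(2)[OF JY] that bound[OF JY q(1)[OF JY] q(2)[OF JY]] by (rule signed_partial_sum_le)
  \<comment> \<open>Here \<open>onorm J\<close> cancels and the distortion of \<open>J\<close>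
    disappears from the constant. If \<open>onorm J = 0\<close>, the lower bound on \<open>J\<close>
    forces \<open>x = 0\<close>.\<close>
  have norm_x: "norm x \<le> K * norm z" if "onorm J * norm x \<le> K * norm (J z)" "K \<ge> 0" for x z :: 'a and K
  proof (cases "onorm J = 0")
    case True
    then have "norm (J x) \<le> 0" using onorm[OF blJ, of x] by simp
    then have "a * norm x \<le> 0" using a(2)[of x] by linarith
    then show ?thesis using a(1) that(2) by (simp add: mult_le_0_iff)
  next
    case False
    then have pos: "onorm J > 0" using onorm_pos_le[OF blJ] by simp
    have "onorm J * norm x \<le> K * (onorm J * norm z)"
      using that onorm[OF blJ, of z] by (meson mult_left_mono order_trans)
    then have "onorm J * norm x \<le> onorm J * (K * norm z)" by (simp add: mult_ac)
    then show ?thesis using pos by simp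
  qed
  define K where "K = c * (1 + \<delta>)"
  have "K = c + \<epsilon> / 2" using c by (simp add: K_def \<delta>_def field_simps)
  then have K: "K \<ge> 0" "K + \<epsilon> / 4 = lam + \<epsilon>" using c \<epsilon> by (simp_all add: c_def)
  have R_signed: "norm (R (\<Sum>i<N. \<theta> i *\<^sub>R q (J x) i)) \<le> K * norm x" if "sign_sequence \<theta>" for \<theta> N x
  proof (rule norm_x[OF _ K(1)])
    have "(\<Sum>i<N. \<theta> i *\<^sub>R q (J x) i) \<in> Y"
      by (intro subspace_sum[OF Y(1)] subspace_scale[OF Y(1)] qY)
    then have "onorm J * norm (R (\<Sum>i<N. \<theta> i *\<^sub>R q (J x) i)) \<le> c * norm (\<Sum>i<N. \<theta> i *\<^sub>R q (J x) i)"
      by (intro JP JR[symmetric])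
    also have "\<dots> \<le> c * ((1 + \<delta>) * norm (J x))" using c by (intro mult_left_mono signed that) auto
    finally show "onorm J * norm (R (\<Sum>i<N. \<theta> i *\<^sub>R q (J x) i)) \<le> K * norm (J x)"
      by (simp add: K_def mult_ac)
  qed
  have one: "sign_sequence (\<lambda>_. 1)" by (simp add: sign_sequence_def)
  have bl: "bounded_linear (\<lambda>x. R (\<Sum>i<n. q (J x) i))" for n
  proof (rule bounded_linear_intro[where K = K])
    show "R (\<Sum>i<n. q (J (x + y)) i) = R (\<Sum>i<n. q (J x) i) + R (\<Sum>i<n. q (J y) i)" for x y
      by (simp add: linear_add[OF linJ] q(3) JY sum.distrib R_add subspace_sum[OF Y(1)] qY)
    show "R (\<Sum>i<n. q (J (r *\<^sub>R x)) i) = r *\<^sub>R R (\<Sum>i<n. q (J x) i)" for r x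
      by (simp add: linear_scale[OF linJ] q(4) JY scaleR_sum_right[symmetric] R_scale subspace_sum[OF Y(1)] qY)
    show "norm (R (\<Sum>i<n. q (J x) i)) \<le> norm x * K" for x
      using R_signed[OF one, of x n] by (simp add: mult.commute)
  qed
  \<comment> \<open>With sums over \<open>i<n\<close>, \<open>T 0\<close> is the empty sum and
    \<open>T (Suc i) - T i\<close> is coordinate \<open>i\<close> carried back by
    \<open>R\<close>.\<close>
  define T where "T n = Blinfun (\<lambda>x. R (\<Sum>i<n. q (J x) i))" for n
  have T: "T n x = R (\<Sum>i<n. q (J x) i)" for n x
    unfolding T_def by (simp add: bounded_linear_Blinfun_apply[OF bl])
  have "\<exists>S :: nat \<Rightarrow> 'a \<Rightarrow>\<^sub>L 'a. approximating_sequence S \<and>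
    (\<forall>\<theta> N. sign_sequence \<theta> \<longrightarrow> norm (\<Sum>i=1..N. \<theta> i *\<^sub>R increment S i) \<le> K + \<epsilon> / 4)"
  proof (rule approximating_sequence_perturbation)
    show "T 0 = 0" by (rule blinfun_eqI) (simp add: T R0)
    show "\<epsilon> / 4 > 0" using \<epsilon> by simp
    show "finite_dimensional (range (T n))" for n
    proof -
      have "\<forall>i. \<exists>B. finite B \<and> E i = span B" using EY(2) unfolding finite_dimensional_def by blast
      then obtain B where B: "\<And>i. finite (B i)" "\<And>i. E i = span (B i)" by metis
      have "T n x \<in> span (\<Union>i<n. R ` B i)" for x
      proof -
        have "R (q (J x) i) \<in> span (\<Union>i<n. R ` B i)" if "i < n" for i
        proof -
          have "B i \<subseteq> Y" using B(2) EY(1) span_superset by blast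
          then have "R (q (J x) i) \<in> span (R ` B i)"
            using q(1)[OF JY] B(2) R_add R_scale by (intro linear_on_subspace_span[OF Y(1)]) auto
          then show ?thesis using span_mono[of "R ` B i" "\<Union>i<n. R ` B i"] that by blast
        qed
        then show ?thesis unfolding T R_sum[OF qY] by (intro span_sum) auto
      qed
      then show ?thesis
        using B(1) by (intro finite_dimensional_subset[of _ "\<Union>i<n. R ` B i"] linear_subspace_image
            bounded_linear.linear[OF blinfun.bounded_linear_right] subspace_UNIV) auto
    qed
    show "(\<lambda>n. T n x) \<longlonglongrightarrow> x" for x
    proof -
      have lim: "(\<lambda>n. \<Sum>i<n. q (J x) i) \<longlonglongrightarrow> J x" using q(2)[OF JY] by (simp add: sums_def)
      have "(\<lambda>n. T n x - x) \<longlonglongrightarrow> 0"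
      proof (rule Lim_null_comparison)
        show "\<forall>\<^sub>F n in sequentially. norm (T n x - x) \<le> c / a * norm ((\<Sum>i<n. q (J x) i) - J x)"
        proof (intro always_eventually allI)
          fix n
          have "T n x - x = R ((\<Sum>i<n. q (J x) i) - J x)"
            unfolding T R_diff[OF subspace_sum[OF Y(1) qY] JY] RJ ..
          then show "norm (T n x - x) \<le> c / a * norm ((\<Sum>i<n. q (J x) i) - J x)"
            using R_bound[OF subspace_diff[OF Y(1) subspace_sum[OF Y(1) qY] JY]] a(1)
            by (simp add: field_simps)
        qed
        have "(\<lambda>n. c / a * norm ((\<Sum>i<n. q (J x) i) - J x)) \<longlonglongrightarrow> c / a * norm (J x - J x)"
          by (intro tendsto_intros lim)
        then show "(\<lambda>n. c / a * norm ((\<Sum>i<n. q (J x) i) - J x)) \<longlonglongrightarrow> 0" by simp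
      qed
      then show ?thesis by (simp add: Lim_null[symmetric])
    qed
    show "norm (\<Sum>i<N. \<theta> i *\<^sub>R (T (Suc i) - T i)) \<le> K" if \<theta>: "sign_sequence \<theta>" for \<theta> N
    proof (rule norm_blinfun_bound[OF K(1)])
      fix x
      have "(\<Sum>i<N. \<theta> i *\<^sub>R (T (Suc i) - T i)) x = (\<Sum>i<N. \<theta> i *\<^sub>R (T (Suc i) x - T i x))"
        by (simp add: blinfun.sum_left blinfun.scaleR_left blinfun.diff_left)
      also have "\<dots> = (\<Sum>i<N. R (\<theta> i *\<^sub>R q (J x) i))"
        by (simp only: T R_sum[OF qY] R_scale[OF qY]) simp
      also have "\<dots> = R (\<Sum>i<N. \<theta> i *\<^sub>R q (J x) i)"
        by (rule R_sum[symmetric]) (intro subspace_scale[OF Y(1)] qY)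
      finally show "norm ((\<Sum>i<N. \<theta> i *\<^sub>R (T (Suc i) - T i)) x) \<le> K * norm x"
        using R_signed[OF \<theta>] by simp
    qed
  qed
  then show "\<exists>S :: nat \<Rightarrow> 'a \<Rightarrow>\<^sub>L 'a. approximating_sequence S \<and>
        (\<forall>N\<ge>1. \<forall>\<theta>. sign_sequence \<theta> \<longrightarrow>
           norm (\<Sum>i=1..N. \<theta> i *\<^sub>R increment S i) \<le> lam + \<epsilon>)"
    unfolding K(2) by blast
qed

section \<open>The UBAP gives a complemented embedding\<close>

text \<open>A pair consists of the index of a functional and a finite list of signs; only
  surjectivity of the coding is used.\<close>

definition pattern :: "nat \<Rightarrow> nat \<times> bool list" where
  "pattern = from_nat"

text \<open>Entry \<open>j\<close> of a vector \<open>x\<close> standing in position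
  \<open>n\<close>. The list length acts as a cutoff, so one list encodes both a partial sum and its
  signs.\<close>

definition signed_coordinate :: "(nat \<Rightarrow> 'a \<Rightarrow> real) \<Rightarrow> nat \<Rightarrow> 'a \<Rightarrow> nat \<Rightarrow> real" where
  "signed_coordinate \<phi> n x j = (case pattern j of (k, bs) \<Rightarrow>
     if n < length bs then (if bs ! n then 1 else - 1) * \<phi> k x else 0)"

lemma pattern_surj: "\<exists>j. pattern j = p"
  unfolding pattern_def by (metis from_nat_to_nat)

text \<open>The filler -1 beyond the end completes a sign sequence; the signed sums taken with it
  stop at or before \<open>length bs\<close>.\<close>

definition list_sign :: "bool list \<Rightarrow> nat \<Rightarrow> real" where
  "list_sign bs i = (if i < length bs \<and> bs ! i then 1 else - 1)"

lemma sign_sequence_list_sign: "sign_sequence (list_sign bs)"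
  by (simp add: sign_sequence_def list_sign_def)

lemma list_sign_map:
  assumes "sign_sequence \<theta>" "i < n"
  shows "list_sign (map (\<lambda>i. \<theta> i = 1) [0..<n]) i = \<theta> i"
  using assms by (auto simp: list_sign_def sign_sequence_def)

section \<open>The supremum of signed partial sums as a norm inside l-infinity\<close>

locale norming_sequence =
  fixes \<phi> :: "nat \<Rightarrow> 'a::banach \<Rightarrow> real" and U :: "(nat \<Rightarrow>\<^sub>C real) \<Rightarrow> 'b::banach"
  assumes linear_\<phi>: "\<And>k. linear (\<phi> k)" and \<phi>_le: "\<And>k x. \<bar>\<phi> k x\<bar> \<le> norm x"
    and norm_le_\<phi>: "\<And>x C. (\<And>k. \<bar>\<phi> k x\<bar> \<le> C) \<Longrightarrow> norm x \<le> C"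
    and linear_U: "linear U" and norm_U: "\<And>f. norm (U f) = norm f"
begin

definition V :: "nat \<Rightarrow> 'a \<Rightarrow> (nat \<Rightarrow>\<^sub>C real)" where
  "V n x = Bcontfun (signed_coordinate \<phi> n x)"

lemma abs_signed_coordinate_le: "\<bar>signed_coordinate \<phi> n x j\<bar> \<le> norm x"
  using \<phi>_le by (auto simp: signed_coordinate_def split: prod.split)

lemma V_apply: "apply_bcontfun (V n x) j = signed_coordinate \<phi> n x j"
proof -
  have "signed_coordinate \<phi> n x \<in> bcontfun"
    by (rule bcontfun_normI) (use abs_signed_coordinate_le in auto)
  then show ?thesis unfolding V_def by (simp add: Bcontfun_inverse)
qed

lemma linear_V: "linear (V n)"
  by (rule linearI; rule bcontfun_eqI)
    (auto simp: V_apply signed_coordinate_def linear_add[OF linear_\<phi>] linear_scale[OF linear_\<phi>]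
      algebra_simps split: prod.split)

definition W :: "nat \<Rightarrow> 'a \<Rightarrow> 'b" where
  "W n x = U (V n x)"

lemma linear_W: "linear (W n)"
proof -
  have "W n = U \<circ> V n" by (auto simp: W_def)
  then show ?thesis using linear_compose[OF linear_V linear_U] by simp
qed

text \<open>Each entry is a functional applied to a signed partial sum, so the supremum over
  \<open>j\<close> is the largest norm of a signed partial sum with at most \<open>N\<close> terms.
  \<open>norm_sum_W_le\<close> and \<open>norm_signed_sum_le\<close> are the two halves of this
  identification.\<close>

lemma sum_V_apply:
  assumes "pattern j = (k, bs)"
  shows "apply_bcontfun (\<Sum>i<N. V i (x i)) j = \<phi> k (\<Sum>i<min N (length bs). list_sign bs i *\<^sub>R x i)"
proof -
  have "apply_bcontfun (\<Sum>i<N. V i (x i)) j = (\<Sum>i<N. signed_coordinate \<phi> i (x i) j)"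
    by (induction N) (auto simp: V_apply)
  also have "\<dots> = (\<Sum>i<min N (length bs). list_sign bs i * \<phi> k (x i))"
    using assms by (intro sum.mono_neutral_cong_right) (auto simp: signed_coordinate_def list_sign_def)
  also have "\<dots> = \<phi> k (\<Sum>i<min N (length bs). list_sign bs i *\<^sub>R x i)"
    by (simp add: linear_sum[OF linear_\<phi>] linear_scale[OF linear_\<phi>])
  finally show ?thesis .
qed

lemma norm_sum_W: "norm (\<Sum>i<N. W i (x i)) = norm (\<Sum>i<N. V i (x i))"
  by (simp add: W_def linear_sum[OF linear_U, symmetric] norm_U)

lemma norm_sum_W_le:
  assumes "\<And>\<theta> M. sign_sequence \<theta> \<Longrightarrow> M \<le> N \<Longrightarrow> norm (\<Sum>i<M. \<theta> i *\<^sub>R x i) \<le> C"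
  shows "norm (\<Sum>i<N. W i (x i)) \<le> C"
  unfolding norm_sum_W
proof (rule norm_bound)
  fix j
  obtain k bs where j: "pattern j = (k, bs)" by fastforce
  show "norm (apply_bcontfun (\<Sum>i<N. V i (x i)) j) \<le> C"
    unfolding sum_V_apply[OF j] real_norm_def
    by (rule order_trans[OF \<phi>_le assms[OF sign_sequence_list_sign]]) simp
qed

lemma norm_signed_sum_le:
  assumes "sign_sequence \<theta>" "M \<le> N"
  shows "norm (\<Sum>i<M. \<theta> i *\<^sub>R x i) \<le> norm (\<Sum>i<N. W i (x i))"
  unfolding norm_sum_W
proof (rule norm_le_\<phi>)
  fix k
  let ?bs = "map (\<lambda>i. \<theta> i = 1) [0..<M]"
  obtain j where j: "pattern j = (k, ?bs)" using pattern_surj by blast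
  have "(\<Sum>i<M. \<theta> i *\<^sub>R x i) = (\<Sum>i<M. list_sign ?bs i *\<^sub>R x i)"
    by (intro sum.cong refl) (simp add: list_sign_map[OF assms(1)])
  then have "\<phi> k (\<Sum>i<M. \<theta> i *\<^sub>R x i) = apply_bcontfun (\<Sum>i<N. V i (x i)) j"
    unfolding sum_V_apply[OF j] using assms(2) by (simp add: min_def)
  then show "\<bar>\<phi> k (\<Sum>i<M. \<theta> i *\<^sub>R x i)\<bar> \<le> norm (\<Sum>i<N. V i (x i))"
    using norm_bounded[of "\<Sum>i<N. V i (x i)" j] by simp
qed

lemma norm_sum_le_W: "norm (\<Sum>i<N. x i) \<le> norm (\<Sum>i<N. W i (x i))"
  using norm_signed_sum_le[of "\<lambda>_. 1" N N x] by (simp add: sign_sequence_def)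

text \<open>A product of two sign sequences is a sign sequence, so changing signs of coordinates
  keeps every signed sum within the original supremum.\<close>

lemma unconditional_family_W:
  assumes "\<And>n. finite_dimensional (G n)"
  shows "unconditional_family (\<lambda>n. W n ` G n)"
proof
  show "finite_dimensional (W n ` G n)" for n
    by (intro finite_dimensional_image linear_W assms)
next
  fix N \<theta> g assume \<theta>: "sign_sequence \<theta>" and "\<And>i. g i \<in> W i ` G i"
  then have "\<forall>i. \<exists>x. g i = W i x" by blast
  then obtain x where x: "\<And>i. g i = W i (x i)" by metis
  have "norm (\<Sum>i<N. W i (\<theta> i *\<^sub>R x i)) \<le> norm (\<Sum>i<N. W i (x i))"
  proof (rule norm_sum_W_le)
    fix \<theta>' :: "nat \<Rightarrow> real" and M assume "sign_sequence \<theta>'" and M: "M \<le> N"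
    then have "sign_sequence (\<lambda>i. \<theta>' i * \<theta> i)"
      using \<theta> unfolding sign_sequence_def by (metis minus_mult_minus mult.right_neutral mult_minus1)
    from norm_signed_sum_le[OF this M, of x]
    show "norm (\<Sum>i<M. \<theta>' i *\<^sub>R \<theta> i *\<^sub>R x i) \<le> norm (\<Sum>i<N. W i (x i))" by simp
  qed
  then show "norm (\<Sum>i<N. \<theta> i *\<^sub>R g i) \<le> norm (\<Sum>i<N. g i)"
    by (simp add: x linear_scale[OF linear_W])
qed

end

section \<open>The embedding of X and its left inverse\<close>

lemma approximating_sequence_increments_eventually_zero:
  assumes S: "approximating_sequence S" and "1 \<le> n" "n < i"
  shows "increment S (Suc i) (S n x) = 0"
proof -
  have "S m (S n x) = S n x" if "n < m" for m
    using S assms(2) that unfolding approximating_sequence_def by (metis blinfun_apply_blinfun_compose)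
  then show ?thesis using assms by (simp add: increment_def blinfun.diff_left)
qed

lemma sum_increments:
  "1 \<le> N \<Longrightarrow> (\<Sum>i<N. increment S (Suc i)) = S N"
  by (induction N rule: dec_induct) (auto simp: increment_def)

lemma complemented_if_UBAP:
  assumes sep: "separable_space (euclidean :: 'a::banach topology)"
    and linf: "contains_l_infinity TYPE('b::banach)"
    and UBAP: "has_UBAP TYPE('a) lam" and \<epsilon>: "\<epsilon> > 0" and lam: "lam \<ge> 1"
  shows "\<exists>Y :: 'b set. banach_subspace Y \<and> has_UFDD Y 1 \<and>
    embeds_complemented TYPE('a) (lam + \<epsilon>) Y"
proof -
  obtain \<phi> :: "nat \<Rightarrow> 'a \<Rightarrow> real" where \<phi>: "\<And>k. linear (\<phi> k)" "\<And>k x. \<bar>\<phi> k x\<bar> \<le> norm x"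
    "\<And>x C. (\<And>k. \<bar>\<phi> k x\<bar> \<le> C) \<Longrightarrow> norm x \<le> C"
    using separable_norming_sequence[OF sep] by blast
  obtain U :: "(nat \<Rightarrow>\<^sub>C real) \<Rightarrow> 'b" where U: "linear U" "\<And>f. norm (U f) = norm f"
    using linf unfolding contains_l_infinity_def by blast
  interpret norming_sequence \<phi> U by (rule norming_sequence.intro[OF \<phi> U])
  define K where "K = lam + \<epsilon>"
  have K: "K \<ge> 0" using lam \<epsilon> by (simp add: K_def)
  obtain S :: "nat \<Rightarrow> 'a \<Rightarrow>\<^sub>L 'a" where S: "approximating_sequence S"
    and S_le: "\<And>N \<theta>. N \<ge> 1 \<Longrightarrow> sign_sequence \<theta> \<Longrightarrow> norm (\<Sum>i=1..N. \<theta> i *\<^sub>R increment S i) \<le> K"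
    using UBAP \<epsilon> unfolding has_UBAP_def K_def by blast
  define A where "A i = increment S (Suc i)" for i
  have fin_S: "finite_dimensional (range (S n))" if "n \<ge> 1" for n
    using S that unfolding approximating_sequence_def by blast
  have lim_S: "(\<lambda>n. S n x) \<longlonglongrightarrow> x" for x
    using S unfolding approximating_sequence_def by blast
  have lin_A: "linear (A i)" for i by (simp add: blinfun.bounded_linear_right bounded_linear.linear)
  have fin_A: "finite_dimensional (range (A i))" for i
  proof (cases "i = 0")
    case True
    then show ?thesis using fin_S[of 1] by (simp add: A_def increment_def)
  next
    case False
    have "finite_dimensional (uminus ` range (S i))"
      by (rule finite_dimensional_image[OF _ fin_S]) (use False in \<open>auto intro: linearI\<close>)
    then have "finite_dimensional (range (blinfun_apply (- S i)))"
      by (simp add: image_image blinfun.minus_left)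
    from finite_dimensional_range_add[OF fin_S[of "Suc i"] this] False
    show ?thesis by (simp add: A_def increment_def)
  qed
  have signed: "norm (\<Sum>i<M. \<theta> i *\<^sub>R A i x) \<le> K * norm x" if \<theta>: "sign_sequence \<theta>" for M \<theta> x
  proof (cases "M = 0")
    case False
    have "(\<Sum>i<M. \<theta> i *\<^sub>R A i x) = (\<Sum>i=1..M. \<theta> (i - 1) *\<^sub>R increment S i) x"
      unfolding blinfun.sum_left blinfun.scaleR_left A_def
      by (rule sum.reindex_bij_witness[of _ "\<lambda>i. i - 1" Suc]) auto
    also have "norm \<dots> \<le> K * norm x"
      using \<theta> False
      by (intro order_trans[OF norm_blinfun] mult_right_mono S_le) (auto simp: sign_sequence_def)
    finally show ?thesis .
  qed (use K in simp)
  interpret unconditional_family "\<lambda>n. W n ` range (A n)"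
    by (rule unconditional_family_W[OF fin_A])
  let ?JN = "\<lambda>x N. \<Sum>i<N. W i (A i x)"
  \<comment> \<open>The only entry of the UBAP constant: it bounds every signed partial sum, hence
    the norm of the embedding.\<close>
  have JN_le: "norm (?JN x N) \<le> K * norm x" for x N
    by (rule norm_sum_W_le[OF signed])
  have JN_diff: "?JN (x - y) N = ?JN x N - ?JN y N" for x y N
    by (simp add: linear_diff[OF linear_W] blinfun.diff_right sum_subtractf)
  have "Cauchy (?JN x)" for x
  proof (rule metric_CauchyI)
    fix e :: real assume e: "e > 0"
    \<comment> \<open>Two errors of size \<open>K * d\<close> must add up to less than
      \<open>e\<close>; \<open>K + 1\<close> makes this strict and the quotient defined.\<close>
    define d where "d = e / (2 * (K + 1))"
    have d: "d > 0" "2 * (K * d) < e" using e K by (simp_all add: d_def field_simps)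
    obtain n0 where "\<forall>n\<ge>n0. dist (S n x) x < d" using metric_LIMSEQ_D[OF lim_S d(1)] by blast
    then obtain n where n: "n \<ge> 1" "dist (S n x) x < d" by (metis nat_le_linear)
    \<comment> \<open>\<open>Suc n\<close> and not \<open>n\<close>: idempotence of
      \<open>S n\<close> is not assumed, so \<open>A n\<close> need not vanish at
      \<open>S n x\<close>, whereas all later increments do.\<close>
    have const: "?JN (S n x) N = ?JN (S n x) (Suc n)" if "N \<ge> Suc n" for N
      using that n(1) approximating_sequence_increments_eventually_zero[OF S]
      by (intro sum.mono_neutral_right) (auto simp: A_def linear_0[OF linear_W])
    have close: "dist (?JN x N) (?JN (S n x) (Suc n)) \<le> K * d" if "N \<ge> Suc n" for N
    proof -
      have "dist (?JN x N) (?JN (S n x) (Suc n)) = norm (?JN (x - S n x) N)"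
        unfolding JN_diff const[OF that, symmetric] by (rule dist_norm)
      also have "\<dots> \<le> K * norm (x - S n x)" by (rule JN_le)
      also have "\<dots> \<le> K * d" using n(2) K by (intro mult_left_mono) (auto simp: dist_norm norm_minus_commute)
      finally show ?thesis .
    qed
    have "dist (?JN x N) (?JN x M) < e" if "N \<ge> Suc n" "M \<ge> Suc n" for M N
      using close[OF that(1)] close[OF that(2)] d(2)
        dist_triangle2[of "?JN x N" "?JN x M" "?JN (S n x) (Suc n)"] by linarith
    then show "\<exists>M. \<forall>m\<ge>M. \<forall>n\<ge>M. dist (?JN x m) (?JN x n) < e" by blast
  qed
  then have "\<forall>x. \<exists>y. ?JN x \<longlonglongrightarrow> y" using Cauchy_convergent_iff convergent_def by blast
  then obtain J where J: "\<And>x. ?JN x \<longlonglongrightarrow> J x" by metis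
  have J_sums: "(\<lambda>i. W i (A i x)) sums J x" for x using J by (simp add: sums_def)
  have JY: "J x \<in> sum_space" for x
    unfolding sum_space_def mem_Collect_eq by (intro exI[of _ "\<lambda>i. W i (A i x)"] conjI J_sums) auto
  have J_le: "norm (J x) \<le> K * norm x" for x
    using JN_le by (intro LIMSEQ_le_const2[OF tendsto_norm[OF J]]) auto
  have J_add: "J (x + y) = J x + J y" for x y
    by (rule sums_unique2[OF J_sums])
      (use sums_add[OF J_sums J_sums] in \<open>simp add: linear_add[OF linear_W] blinfun.add_right\<close>)
  have J_scale: "J (r *\<^sub>R x) = r *\<^sub>R J x" for r x
    by (rule sums_unique2[OF J_sums])
      (use sums_scaleR_right[OF J_sums] in \<open>simp add: linear_scale[OF linear_W] blinfun.scaleR_right\<close>)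
  have blJ: "bounded_linear J"
    using J_add J_scale J_le by (intro bounded_linear_intro[where K = K]) (auto simp: mult.commute)
  \<comment> \<open>The graph of the left inverse. As a relation it requires no choice of the
    \<open>e n\<close>; it is single-valued because it is linear and contractive.\<close>
  define adds where "adds y x \<longleftrightarrow> (\<exists>e. (\<forall>n. e n \<in> range (A n)) \<and> (\<lambda>n. W n (e n)) sums y \<and> e sums x)" for y x
  have adds_J: "adds (J x) x" for x
  proof -
    have "(\<lambda>i. A i x) sums x"
      unfolding sums_def
    proof (rule Lim_transform_eventually[OF lim_S])
      show "\<forall>\<^sub>F n in sequentially. S n x = (\<Sum>i<n. A i x)"
        using eventually_ge_at_top[of 1]
        by eventually_elim (simp add: sum_increments[of _ S, symmetric] A_def blinfun.sum_left)
    qed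
    then show ?thesis
      unfolding adds_def by (intro exI[of _ "\<lambda>i. A i x"] conjI J_sums) auto
  qed
  have adds_ex: "\<exists>x. adds y x" if y: "y \<in> sum_space" for y
  proof -
    obtain f where f: "\<And>n. f n \<in> W n ` range (A n)" "f sums y"
      using y unfolding sum_space_def by blast
    then have "\<forall>n. \<exists>e. e \<in> range (A n) \<and> f n = W n e" by blast
    then obtain e where e: "\<And>n. e n \<in> range (A n)" "\<And>n. f n = W n (e n)" by metis
    \<comment> \<open>Padding with zeros extends the contraction to blocks, so the Cauchy property
      passes from the \<open>W n (e n)\<close> to the \<open>e n\<close>.\<close>
    have e_le: "norm (\<Sum>i=m..<n. e i) \<le> norm (\<Sum>i=m..<n. W i (e i))" for m n
    proof -
      let ?g = "\<lambda>i. if m \<le> i then e i else 0"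
      have "(\<Sum>i<n. ?g i) = (\<Sum>i=m..<n. e i)" by (intro sum.mono_neutral_cong_right) auto
      moreover have "(\<Sum>i<n. W i (?g i)) = (\<Sum>i=m..<n. W i (e i))"
        by (intro sum.mono_neutral_cong_right) (auto simp: linear_0[OF linear_W])
      ultimately show ?thesis using norm_sum_le_W[of ?g n] by simp
    qed
    have "summable (\<lambda>n. W n (e n))" using f(2) e(2) by (simp add: sums_iff flip: e(2))
    then have "summable e"
      unfolding summable_Cauchy using e_le by (meson le_less_trans)
    then show ?thesis
      unfolding adds_def using e f by (auto intro!: exI[of _ e] summable_sums simp flip: e(2))
  qed
  have adds_le: "norm x \<le> norm y" if yx: "adds y x" for x y
  proof -
    obtain e where e: "(\<lambda>n. W n (e n)) sums y" "e sums x" using yx unfolding adds_def by blast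
    show ?thesis
    proof (rule LIMSEQ_le)
      show "(\<lambda>N. norm (\<Sum>i<N. e i)) \<longlonglongrightarrow> norm x"
        using e(2) unfolding sums_def by (rule tendsto_norm)
      show "(\<lambda>N. norm (\<Sum>i<N. W i (e i))) \<longlonglongrightarrow> norm y"
        using e(1) unfolding sums_def by (rule tendsto_norm)
    qed (use norm_sum_le_W in auto)
  qed
  have sub_A: "subspace (range (A n))" for n using fin_A finite_dimensional_subspace by blast
  have adds_lin: "adds (r *\<^sub>R y + y') (r *\<^sub>R x + x')" if yx: "adds y x" "adds y' x'" for r x x' y y'
  proof -
    obtain e e' where e: "\<forall>n. e n \<in> range (A n)" "(\<lambda>n. W n (e n)) sums y" "e sums x"
      and e': "\<forall>n. e' n \<in> range (A n)" "(\<lambda>n. W n (e' n)) sums y'" "e' sums x'"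
      using yx unfolding adds_def by blast
    have "(\<lambda>n. W n (r *\<^sub>R e n + e' n)) = (\<lambda>n. r *\<^sub>R W n (e n) + W n (e' n))"
      by (simp add: linear_add[OF linear_W] linear_scale[OF linear_W])
    moreover have "\<forall>n. r *\<^sub>R e n + e' n \<in> range (A n)"
      by (intro allI subspace_add[OF sub_A] subspace_scale[OF sub_A] e(1)[rule_format] e'(1)[rule_format])
    ultimately show ?thesis
      unfolding adds_def using sums_add[OF sums_scaleR_right[OF e(2)] e'(2), of r]
        sums_add[OF sums_scaleR_right[OF e(3)] e'(3), of r]
      by (intro exI[of _ "\<lambda>n. r *\<^sub>R e n + e' n"] conjI) auto
  qed
  \<comment> \<open>With factor -1, the difference of the two values is related to 0, hence has norm
    at most 0.\<close>
  have adds_unique: "x = x'" if "adds y x" "adds y x'" for x x' y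
    using adds_le[OF adds_lin[OF that, of "-1"]] by simp
  define s where "s y = (SOME x. adds y x)" for y
  have s: "adds y (s y)" if "y \<in> sum_space" for y
    unfolding s_def using adds_ex[OF that] by (rule someI_ex)
  have s_eq: "s y = x" if "adds y x" for x y
    unfolding s_def using that adds_unique by blast
  have sJ: "s (J x) = x" for x using s_eq adds_J by blast
  have s_le: "norm (s y) \<le> norm y" if "y \<in> sum_space" for y using adds_le[OF s[OF that]] .
  have low: "1 * norm x \<le> norm (J x)" for x using adds_le[OF adds_J] by simp
  have adds_0: "adds 0 0" using adds_J[of 0] J_scale[of 0 0] by simp
  have s_add: "s (y + y') = s y + s y'" if "y \<in> sum_space" "y' \<in> sum_space" for y y'
    using s_eq[OF adds_lin[OF s s, of y y' 1]] that by simp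
  have s_scale: "s (r *\<^sub>R y) = r *\<^sub>R s y" if "y \<in> sum_space" for r y
    using s_eq[OF adds_lin[OF s adds_0, of y r]] that by simp
  have "banach_subspace (range J)"
  proof -
    have "complete (range J)"
      using complete_isometric_image[of 1 UNIV J] blJ low by (simp add: complete_UNIV)
    then show ?thesis
      unfolding banach_subspace_def
      using linear_subspace_image[OF bounded_linear.linear[OF blJ] subspace_UNIV] complete_imp_closed by blast
  qed
  moreover have "norm (J (s y)) \<le> K * norm y" if "y \<in> sum_space" for y
    using J_le[of "s y"] mult_left_mono[OF s_le[OF that] K] by linarith
  ultimately have "projection_bounded_by K sum_space (range J) (\<lambda>y. J (s y))"
    unfolding projection_bounded_by_def linear_into_def
    using JY by (auto simp: sJ s_add s_scale J_add J_scale)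
  moreover have "isomorphic_embedding J"
    unfolding isomorphic_embedding_def using blJ low zero_less_one by blast
  \<comment> \<open>\<open>J\<close> has norm at most \<open>K\<close> and its left inverse
    \<open>s\<close> norm at most 1, so the product of the norms stays within
    \<open>K\<close>.\<close>
  moreover have "onorm J * norm x \<le> K * norm y" if "y \<in> sum_space" "J (s y) = J x" for x y
  proof -
    have "x = s y" using sJ that(2) by metis
    moreover have "onorm J \<le> K" by (rule onorm_bound[OF K J_le])
    ultimately show ?thesis using s_le[OF that(1)] K by (simp add: mult_mono)
  qed
  ultimately have "embeds_complemented TYPE('a) K sum_space"
    unfolding embeds_complemented_def by (intro exI[of _ J] exI[of _ "\<lambda>y. J (s y)"]) blast
  then show ?thesis
    using banach_subspace_sum_space has_UFDD_sum_space unfolding K_def by blast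
qed

theorem theorem1p2:
  fixes lam :: real
  assumes "separable_space (euclidean :: 'a::banach topology)"
    and "lam \<ge> 1"
    and "contains_l_infinity TYPE('b::banach)"
  shows "has_UBAP TYPE('a) lam \<longleftrightarrow>
    (\<forall>\<epsilon>>0. \<exists>Y :: 'b set. banach_subspace Y \<and> has_UFDD Y 1 \<and>
       embeds_complemented TYPE('a) (lam + \<epsilon>) Y)"
proof
  assume "has_UBAP TYPE('a) lam"
  then show "\<forall>\<epsilon>>0. \<exists>Y :: 'b set. banach_subspace Y \<and> has_UFDD Y 1 \<and>
      embeds_complemented TYPE('a) (lam + \<epsilon>) Y"
    using complemented_if_UBAP[OF assms(1,3)] assms(2) by blast
next
  assume "\<forall>\<epsilon>>0. \<exists>Y :: 'b set. banach_subspace Y \<and> has_UFDD Y 1 \<and>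
      embeds_complemented TYPE('a) (lam + \<epsilon>) Y"
  then show "has_UBAP TYPE('a) lam"
    by (intro UBAP_if_complemented[OF assms(2)]) blast
qed

end
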